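(* Let $\Lambda$ be a group with finite generating set $S$, let $\lambda$ be its left regular representation, and for each $n\in\mathbb{N}$ let $\pi_n:\Lambda\to\mathcal{U}(n)$ be a random unitary representation. Suppose the following two assumptions hold. (A1) There exist a constant $C\ge 1$ and constants $u_k(\gamma)\in\mathbb{R}$ for all $k\in\mathbb{Z}_{\ge0}$ and $\gamma\in\Lambda$ such that $u_0(\gamma)=\tau(\lambda(\gamma))$ and $$\left|\mathbb{E}\big[\mathrm{tr}\,\pi_n(\gamma)\big]-\sum_{k=0}^{q-1}\frac{u_k(\gamma)}{n^k}\right|\le\frac{(Cq)^{Cq}}{n^q}$$ for all $\gamma\in\Lambda$ and all $q,n\in\mathbb{N}$ with $q\ge|\gamma|$ and $n\ge Cq^C$. (A2) Extending $u_1$ linearly to $\mathbb{C}[\Lambda]$, for every self-adjoint $x\in\mathbb{C}[\Lambda]$, $$\limsup_{p\to\infty}|u_1(x^p)|^{1/p}\le\|\lambda(x)\|.$$ Then for every $x\in\mathbb{C}[\Lambda]$, $$\|\pi_n(x)\|\le\|\lambda(x)\|+o(1)\quad\text{with probability}\quad 1-o(1)$$ as $n\to\infty$; that is, for every $\varepsilon>0$, $\mathbb{P}[\|\pi_n(x)\|\le\|\lambda(x)\|+\varepsilon]\to1$ as $n\to\infty$.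
   Context: $\mathbb{N}=\{1,2,\dots\}$. $|\gamma|$ is the word length of $\gamma\in\Lambda$ with respect to $S$ (letters from $S$ and inverses). For an $n\times n$ matrix $M$, $\mathrm{tr}\,M=\frac1n\mathrm{Tr}\,M$ is the normalized trace. $\tau(a)=\langle\delta_e,a\delta_e\rangle$ is the canonical trace on the reduced group $C^*$-algebra, so $\tau(\lambda(\gamma))=1_{\gamma=e}$. Representations are extended linearly to the group algebra $\mathbb{C}[\Lambda]$, which carries the involution $(\sum_\gamma\alpha_\gamma\gamma)^*=\sum_\gamma\bar\alpha_\gamma\gamma^{-1}$; $x$ is self-adjoint if $x^*=x$. Norms are operator norms. *)

theory Defs
  imports
    "HOL-Probability.Probability_Measure"
    "HOL-Library.Poly_Mapping"
    "Jordan_Normal_Form.Schur_Decomposition"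
begin

text \<open>
  An arbitrary group is rendered by a type of class \<open>group_add\<close>. This class does not
  assume commutativity: the group law is merely written additively, so the identity is \<open>0\<close>,
  the product of \<open>a\<close> and \<open>b\<close> is \<open>a + b\<close>, and the inverse of \<open>a\<close> is \<open>- a\<close>.
  The library type \<open>'g \<Rightarrow>\<^sub>0 complex\<close> of finitely supported functions, whose multiplication is
  convolution, is then the complex group algebra.
\<close>

section \<open>Generators, word length and the group algebra\<close>

definition words :: "'g::group_add set \<Rightarrow> 'g list set" where
  "words S = lists (S \<union> uminus ` S)"

definition generates :: "'g::group_add set \<Rightarrow> bool" where
  "generates S \<longleftrightarrow> (\<forall>g. \<exists>w\<in>words S. sum_list w = g)"

definition word_length :: "'g::group_add set \<Rightarrow> 'g \<Rightarrow> nat" where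
  "word_length S g = (LEAST k. \<exists>w\<in>words S. length w = k \<and> sum_list w = g)"

type_synonym 'g group_algebra = "'g \<Rightarrow>\<^sub>0 complex"

text \<open>The coefficient of the involution at \<open>g\<close> is the conjugate of the coefficient at \<open>- g\<close>.\<close>
definition ga_star :: "'g::group_add group_algebra \<Rightarrow> 'g group_algebra" where
  "ga_star x = Poly_Mapping.map cnj (Poly_Mapping.map_key uminus x)"

definition ga_selfadjoint :: "'g::group_add group_algebra \<Rightarrow> bool" where
  "ga_selfadjoint x \<longleftrightarrow> ga_star x = x"

text \<open>The linear extension of a scalar function on the group to the group algebra.\<close>
definition ga_linear_ext :: "('g \<Rightarrow> complex) \<Rightarrow> 'g group_algebra \<Rightarrow> complex" where
  "ga_linear_ext f x = (\<Sum>g\<in>Poly_Mapping.keys x. Poly_Mapping.lookup x g * f g)"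

section \<open>The left regular representation\<close>

definition ell2 :: "('g \<Rightarrow> complex) set" where
  "ell2 = {f. (\<lambda>h. (cmod (f h))\<^sup>2) summable_on UNIV}"

definition ell2_norm :: "('g \<Rightarrow> complex) \<Rightarrow> real" where
  "ell2_norm f = sqrt (\<Sum>\<^sub>\<infinity>h. (cmod (f h))\<^sup>2)"

definition ell2_inner :: "('g \<Rightarrow> complex) \<Rightarrow> ('g \<Rightarrow> complex) \<Rightarrow> complex" where
  "ell2_inner f f' = (\<Sum>\<^sub>\<infinity>h. cnj (f h) * f' h)"

definition delta :: "'g \<Rightarrow> 'g \<Rightarrow> complex" where
  "delta g = (\<lambda>h. if h = g then 1 else 0)"

text \<open>The operator norm, for operators that map \<^const>\<open>ell2\<close> boundedly to itself.\<close>
definition ell2_opnorm :: "(('g \<Rightarrow> complex) \<Rightarrow> ('g \<Rightarrow> complex)) \<Rightarrow> real" where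
  "ell2_opnorm a = (SUP f \<in> {f \<in> ell2. ell2_norm f \<le> 1}. ell2_norm (a f))"

definition left_regular :: "'g::group_add \<Rightarrow> ('g \<Rightarrow> complex) \<Rightarrow> ('g \<Rightarrow> complex)" where
  "left_regular g f = (\<lambda>h. f (- g + h))"

definition left_regular_ext :: "'g::group_add group_algebra \<Rightarrow> ('g \<Rightarrow> complex) \<Rightarrow> ('g \<Rightarrow> complex)" where
  "left_regular_ext x f = (\<lambda>h. \<Sum>g\<in>Poly_Mapping.keys x. Poly_Mapping.lookup x g * left_regular g f h)"

definition canonical_trace :: "(('g::group_add \<Rightarrow> complex) \<Rightarrow> ('g \<Rightarrow> complex)) \<Rightarrow> complex" where
  "canonical_trace a = ell2_inner (delta 0) (a (delta 0))"

section \<open>Finite-dimensional unitary representations\<close>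

definition unitary_mat :: "nat \<Rightarrow> complex mat \<Rightarrow> bool" where
  "unitary_mat n U \<longleftrightarrow> U \<in> carrier_mat n n \<and> U * mat_adjoint U = 1\<^sub>m n \<and> mat_adjoint U * U = 1\<^sub>m n"

definition unitary_rep :: "nat \<Rightarrow> ('g::group_add \<Rightarrow> complex mat) \<Rightarrow> bool" where
  "unitary_rep n \<rho> \<longleftrightarrow>
     (\<forall>g. unitary_mat n (\<rho> g)) \<and> \<rho> 0 = 1\<^sub>m n \<and> (\<forall>g h. \<rho> (g + h) = \<rho> g * \<rho> h)"

definition rep_ext :: "nat \<Rightarrow> ('g \<Rightarrow> complex mat) \<Rightarrow> 'g group_algebra \<Rightarrow> complex mat" where
  "rep_ext n \<rho> x = Matrix.mat n n (\<lambda>(i, j). \<Sum>g\<in>Poly_Mapping.keys x. Poly_Mapping.lookup x g * \<rho> g $$ (i, j))"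

definition normalized_trace :: "complex mat \<Rightarrow> complex" where
  "normalized_trace A = (\<Sum>i<dim_row A. A $$ (i, i)) / of_nat (dim_row A)"

definition euclidean_norm :: "complex Matrix.vec \<Rightarrow> real" where
  "euclidean_norm v = L2_set (\<lambda>i. cmod (vec_index v i)) {..<dim_vec v}"

definition mat_opnorm :: "complex mat \<Rightarrow> real" where
  "mat_opnorm A =
     (SUP v \<in> {v \<in> carrier_vec (dim_col A). euclidean_norm v \<le> 1}. euclidean_norm (A *\<^sub>v v))"

text \<open>A random representation on \<open>M\<close>; measurability is with respect to the Borel structure
  of the unitary group, that is, measurability of all matrix entries.\<close>
definition random_unitary_rep ::
    "'w measure \<Rightarrow> nat \<Rightarrow> ('w \<Rightarrow> 'g::group_add \<Rightarrow> complex mat) \<Rightarrow> bool" where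
  "random_unitary_rep M n \<rho> \<longleftrightarrow>
     prob_space M \<and>
     (\<forall>\<omega>\<in>space M. unitary_rep n (\<rho> \<omega>)) \<and>
     (\<forall>g. \<forall>i<n. \<forall>j<n. (\<lambda>\<omega>. \<rho> \<omega> g $$ (i, j)) \<in> borel_measurable M)"

end

theory Submission
  imports Defs "HOL-Real_Asymp.Real_Asymp"
begin

text \<open>
  Put \<open>y = x\<^sup>* x\<close>. The nonnegative eigenvalues of \<open>\<pi>\<^sub>n(y)\<close> are bounded by a constant \<open>K\<close>, and the
  largest one is \<open>\<parallel>\<pi>\<^sub>n(x)\<parallel>\<^sup>2\<close>. If a polynomial \<open>h\<close> is nonnegative on \<open>[0, K]\<close> and at least \<open>1\<close> on
  \<open>[(\<parallel>\<lambda>(x)\<parallel> + \<epsilon>)\<^sup>2, K]\<close>, then \<open>\<parallel>\<pi>\<^sub>n(x)\<parallel> > \<parallel>\<lambda>(x)\<parallel> + \<epsilon>\<close> has probability at most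
  \<open>n E[tr h(\<pi>\<^sub>n(y))]\<close>.

  Let \<open>h = g ^ m\<close> with \<open>m\<close> logarithmic in \<open>n\<close>. The polynomial \<open>g\<close> is bounded by \<open>2\<close> on \<open>[0, K]\<close>, while
  \<open>\<Sum>\<^sub>i |g\<^sub>i| r ^ i \<le> 1/16\<close> for some \<open>r > \<parallel>\<lambda>(x)\<parallel>\<^sup>2\<close>. As \<open>|u\<^sub>0(y ^ p)|\<close> and \<open>|u\<^sub>1(y ^ p)|\<close> are of order at
  most \<open>r ^ p\<close>, the first two terms of the expansion of \<open>E[tr h(\<pi>\<^sub>n(y))]\<close> in \<open>1/n\<close> are \<open>o(1/n)\<close>. The rest of
  the expansion is, up to a negligible error, a polynomial in \<open>1/n\<close> of degree \<open>q = O(m)\<close> that is bounded by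
  \<open>2 ^ m + 1\<close> at all \<open>1/n\<close> with \<open>n\<close> at least a power of \<open>q\<close>. Lagrange interpolation at nodes clustering
  quadratically at \<open>0\<close> bounds its terms of order at least two by \<open>q ^ O(1) 2 ^ m / n\<^sup>2\<close>.
\<close>

section \<open>Coefficient norms and interpolation at reciprocals of integers\<close>

text \<open>Nothing is assumed about \<open>u k\<close> for k \<ge> 2, and the error in (A1) carries
  the factor (Cq)^(Cq), so the expansion alone does not control its higher terms. The missing
  information comes from the a priori bound of E[tr h] by the supremum of |h| over [0, K], which
  holds for every n \<ge> 1: a polynomial in 1/n that is bounded at enough points has controlled
  coefficients. These points are reciprocals of integers, which forces the interpolation nodes to be
  rounded. (A1) is applied to every group element in the support of h(y), so q must be at least of
  order deg h, while n must exceed a power of q. Degree O(log n) meets both demands. Two terms must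
  be small by hypothesis because bounding a maximum over n eigenvalues by their sum costs a factor
  n: after multiplication by n, the order zero term grows and the order one term stays, while all
  later ones still carry a factor 1/n. The bounds 2 and 1/16 leave room for a base strictly between
  2 and 16: with n of order 4^m, 2^m/n and n/16^m both decay exponentially in m.\<close>

definition coeff_norm :: "real \<Rightarrow> 'a::real_normed_field poly \<Rightarrow> real" where
  "coeff_norm s p = poly (map_poly norm p) s"

lemma coeff_map_poly_norm [simp]: "coeff (map_poly norm p) i = norm (coeff p i)"
  by (simp add: coeff_map_poly)

lemma poly_mono_coeff:
  fixes p q :: "real poly"
  assumes "\<And>i. coeff p i \<le> coeff q i" and "0 \<le> s"
  shows "poly p s \<le> poly q s"
proof -
  have "0 \<le> poly (q - p) s"
    unfolding poly_altdef using assms by (intro sum_nonneg mult_nonneg_nonneg) auto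
  then show ?thesis by simp
qed

lemma poly_eq_sum_atMost:
  fixes p :: "'a::comm_semiring_1 poly"
  assumes "Polynomial.degree p \<le> n"
  shows "poly p x = (\<Sum>i\<le>n. coeff p i * x ^ i)"
  unfolding poly_altdef by (rule sum.mono_neutral_left) (use assms in \<open>auto simp: coeff_eq_0\<close>)

lemma coeff_norm_eq_sum:
  assumes "Polynomial.degree p \<le> n"
  shows "coeff_norm s p = (\<Sum>i\<le>n. norm (coeff p i) * s ^ i)"
proof -
  have "Polynomial.degree (map_poly norm p) \<le> n"
    using assms degree_map_poly_le le_trans by blast
  then show ?thesis
    by (simp add: coeff_norm_def poly_eq_sum_atMost[of _ n])
qed

lemma coeff_norm_nonneg: "0 \<le> s \<Longrightarrow> 0 \<le> coeff_norm s p"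
  by (simp add: coeff_norm_eq_sum[OF order_refl] sum_nonneg)

text \<open>Taking absolute values inside the convolution of coefficients only enlarges it, and
  evaluation at a nonnegative \<open>s\<close> preserves coefficientwise domination.
  Submultiplicativity is what carries a bound for one polynomial to its powers.\<close>

lemma coeff_norm_mult:
  assumes "0 \<le> s"
  shows "coeff_norm s (p * q) \<le> coeff_norm s p * coeff_norm s q"
proof -
  have "poly (map_poly norm (p * q)) s \<le> poly (map_poly norm p * map_poly norm q) s"
  proof (rule poly_mono_coeff[OF _ assms])
    fix i
    show "coeff (map_poly norm (p * q)) i \<le> coeff (map_poly norm p * map_poly norm q) i"
      by (auto simp: coeff_mult norm_mult intro!: order_trans[OF norm_sum])
  qed
  then show ?thesis by (simp add: coeff_norm_def)
qed

lemma coeff_norm_add: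
  assumes "0 \<le> s"
  shows "coeff_norm s (p + q) \<le> coeff_norm s p + coeff_norm s q"
proof -
  have "poly (map_poly norm (p + q)) s \<le> poly (map_poly norm p + map_poly norm q) s"
    by (rule poly_mono_coeff[OF _ assms]) (simp add: norm_triangle_ineq)
  then show ?thesis by (simp add: coeff_norm_def)
qed

lemma coeff_norm_0 [simp]: "coeff_norm s 0 = 0"
  by (simp add: coeff_norm_def)

lemma coeff_norm_pCons [simp]: "coeff_norm s (pCons a p) = norm a + s * coeff_norm s p"
proof -
  have "map_poly norm (pCons a p) = pCons (norm a) (map_poly norm p)"
    by (rule poly_eqI) (simp add: coeff_pCons split: nat.split)
  then show ?thesis by (simp add: coeff_norm_def)
qed

lemma coeff_norm_1 [simp]: "coeff_norm s 1 = 1"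
  unfolding one_pCons by simp

lemma coeff_norm_smult [simp]: "coeff_norm s (Polynomial.smult c p) = norm c * coeff_norm s p"
proof -
  have "map_poly norm (Polynomial.smult c p) = Polynomial.smult (norm c) (map_poly norm p)"
    by (rule poly_eqI) (simp add: norm_mult)
  then show ?thesis by (simp add: coeff_norm_def)
qed

lemma coeff_norm_uminus [simp]: "coeff_norm s (- p) = coeff_norm s p"
  using coeff_norm_smult[of s "-1" p] by simp

lemma coeff_norm_monom: "coeff_norm s (Polynomial.monom a n) = norm a * s ^ n"
  by (simp add: coeff_norm_def map_poly_monom poly_monom)

lemma coeff_norm_power:
  assumes "0 \<le> s"
  shows "coeff_norm s (p ^ n) \<le> coeff_norm s p ^ n"
proof (induction n)
  case (Suc n)
  have "coeff_norm s (p ^ Suc n) \<le> coeff_norm s p * coeff_norm s (p ^ n)"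
    using coeff_norm_mult[OF assms] by simp
  also have "\<dots> \<le> coeff_norm s p * coeff_norm s p ^ n"
    using Suc coeff_norm_nonneg[OF assms] by (intro mult_left_mono) auto
  finally show ?case by simp
qed simp

lemma coeff_norm_sum:
  assumes "0 \<le> s"
  shows "coeff_norm s (\<Sum>i\<in>I. f i) \<le> (\<Sum>i\<in>I. coeff_norm s (f i))"
proof (induction I rule: infinite_finite_induct)
  case (insert i I)
  then show ?case using coeff_norm_add[OF assms, of "f i" "sum f I"] by simp
qed auto

lemma coeff_norm_prod:
  assumes "0 \<le> s"
  shows "coeff_norm s (\<Prod>i\<in>I. f i) \<le> (\<Prod>i\<in>I. coeff_norm s (f i))"
proof (induction I rule: infinite_finite_induct)
  case (insert i I)
  have "coeff_norm s (\<Prod>i\<in>insert i I. f i) \<le> coeff_norm s (f i) * coeff_norm s (prod f I)"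
    using insert coeff_norm_mult[OF assms] by simp
  also have "\<dots> \<le> coeff_norm s (f i) * (\<Prod>i\<in>I. coeff_norm s (f i))"
    using insert coeff_norm_nonneg[OF assms] by (intro mult_left_mono) auto
  finally show ?case using insert by simp
qed auto

section \<open>Lagrange interpolation with explicit constants\<close>

definition lagrange_recip_basis :: "(nat \<Rightarrow> 'a::field) \<Rightarrow> nat set \<Rightarrow> nat \<Rightarrow> 'a poly" where
  "lagrange_recip_basis a I j = (\<Prod>i\<in>I - {j}. Polynomial.smult (inverse (1 - a i / a j)) [:1, - a i:])"

text \<open>The usual factor (x - 1/a_i) / (1/a_j - 1/a_i), multiplied above and below by -a_i, is
  (1 - a_i x) / (1 - a_i/a_j); in this form its coefficient norm can be read off. The two sides
  differ by a polynomial of degree below \<open>card I\<close> that has \<open>card I\<close>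
  distinct roots.\<close>

lemma lagrange_recip_interpolation:
  fixes P :: "'a::field poly"
  assumes "finite I" and "inj_on a I" and "\<And>i. i \<in> I \<Longrightarrow> a i \<noteq> 0"
    and deg: "Polynomial.degree P < card I"
  shows "P = (\<Sum>j\<in>I. Polynomial.smult (poly P (1 / a j)) (lagrange_recip_basis a I j))" (is "P = ?Q")
proof -
  have ev: "poly (lagrange_recip_basis a I j) (1 / a i) = (if i = j then 1 else 0)"
    if "i \<in> I" "j \<in> I" for i j
  proof (cases "i = j")
    case True
    have "poly (Polynomial.smult (inverse (1 - a i' / a j)) [:1, - a i':]) (1 / a j) = 1"
      if "i' \<in> I - {j}" for i'
    proof -
      have "1 - a i' / a j \<noteq> 0"
        using that \<open>j \<in> I\<close> assms(2,3) by (auto simp: inj_on_def field_simps)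
      moreover have "poly (Polynomial.smult (inverse (1 - a i' / a j)) [:1, - a i':]) (1 / a j)
          = inverse (1 - a i' / a j) * (1 - a i' / a j)"
        by (simp add: right_diff_distrib)
      ultimately show ?thesis by (metis left_inverse)
    qed
    then show ?thesis using True
      unfolding lagrange_recip_basis_def poly_prod by (auto intro!: prod.neutral)
  next
    case False
    have "poly (Polynomial.smult (inverse (1 - a i / a j)) [:1, - a i:]) (1 / a i) = 0"
      using assms(3)[OF that(1)] by (simp add: right_diff_distrib)
    then show ?thesis using that assms(1) False
      unfolding lagrange_recip_basis_def poly_prod by (auto intro!: prod_zero bexI[of _ i])
  qed
  have "Polynomial.degree (lagrange_recip_basis a I j) \<le> card I - 1" if "j \<in> I" for j
  proof -
    have "Polynomial.degree (lagrange_recip_basis a I j)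
        \<le> (\<Sum>i\<in>I - {j}. Polynomial.degree (Polynomial.smult (inverse (1 - a i / a j)) [:1, - a i:]))"
      unfolding lagrange_recip_basis_def
      by (rule degree_prod_sum_le[unfolded o_def]) (simp add: assms(1))
    also have "\<dots> \<le> (\<Sum>i\<in>I - {j}. 1)"
      by (intro sum_mono) auto
    finally show ?thesis using assms(1) that by simp
  qed
  then have "Polynomial.degree ?Q \<le> card I - 1"
    by (intro degree_sum_le assms(1)) (use degree_smult_le le_trans in blast)
  then have dPQ: "Polynomial.degree (P - ?Q) < card I"
    using deg degree_diff_le_max[of P ?Q] by linarith
  have root: "poly (P - ?Q) (1 / a i) = 0" if "i \<in> I" for i
  proof -
    have "poly ?Q (1 / a i) = (\<Sum>j\<in>I. if i = j then poly P (1 / a j) else 0)"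
      unfolding poly_sum poly_smult using ev that by (intro sum.cong) auto
    also have "\<dots> = poly P (1 / a i)" using that assms(1) by simp
    finally show ?thesis by simp
  qed
  have "P - ?Q = 0"
  proof (rule ccontr)
    assume nz: "P - ?Q \<noteq> 0"
    have "card I = card ((\<lambda>i. 1 / a i) ` I)"
      by (subst card_image) (use assms(2) in \<open>auto simp: inj_on_def\<close>)
    also have "\<dots> \<le> card {x. poly (P - ?Q) x = 0}"
      by (intro card_mono[OF poly_roots_finite[OF nz]] image_subsetI CollectI) (rule root)
    also have "\<dots> \<le> Polynomial.degree (P - ?Q)"
      by (rule card_poly_roots_bound[OF nz])
    finally show False using dPQ by simp
  qed
  then show ?thesis by simp
qed

text \<open>By j^2 - i^2 = (j - i)(j + i) the denominators form two runs of consecutive integers,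
  one falling from j - 1 and one rising from j + 1. The case k = j - 1 starts the induction for the
  full product.\<close>

lemma prod_square_quotient_below:
  assumes "k < j"
  shows "(\<Prod>i\<in>{1..k}. real i ^ 2 / \<bar>real i ^ 2 - real j ^ 2\<bar>)
    = fact k ^ 2 * fact (j - 1 - k) * fact j / (fact (j - 1) * fact (j + k))"
  using assms
proof (induction k)
  case (Suc k)
  define d where "d = j - 1 - Suc k"
  have d: "j = d + k + 2" "j - 1 - k = Suc d" "j - 1 = d + k + 1" using Suc.prems by (auto simp: d_def)
  have "real (Suc k) ^ 2 < real j ^ 2"
    using Suc.prems by (intro power_strict_mono) auto
  then have "\<bar>real (Suc k) ^ 2 - real j ^ 2\<bar> = (real j - real (Suc k)) * (real j + real (Suc k))"
    by (simp add: power2_eq_square algebra_simps)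
  also have "\<dots> = real (Suc d) * real (j + Suc k)"
    by (simp add: d)
  finally have e: "\<bar>real (Suc k) ^ 2 - real j ^ 2\<bar> = real (Suc d) * real (j + Suc k)" .
  have "(\<Prod>i\<in>{1..Suc k}. real i ^ 2 / \<bar>real i ^ 2 - real j ^ 2\<bar>)
      = fact k ^ 2 * fact (Suc d) * fact j / (fact (j - 1) * fact (j + k))
        * (real (Suc k) ^ 2 / (real (Suc d) * real (j + Suc k)))"
    using Suc by (simp only: prod.nat_ivl_Suc' e d(2)[symmetric]) (simp add: mult.commute)
  also have "\<dots> = fact (Suc k) ^ 2 * fact d * fact j / (fact (j - 1) * fact (j + Suc k))"
    unfolding add_Suc_right fact_Suc by (simp add: divide_simps power2_eq_square)
  finally show ?case by (simp add: d_def)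
qed (simp add: divide_simps)

text \<open>For a_i exactly proportional to 1/i^2 one has 1 - a_i/a_j = (i^2 - j^2)/i^2, so this is
  the product of the normalizing constants of the j-th Lagrange basis polynomial. Its value is twice
  the quotient of the binomial coefficients (2q over q-j) and (2q over q).\<close>

lemma prod_square_quotient_eq:
  assumes "1 \<le> j" and "j \<le> q"
  shows "(\<Prod>i\<in>{1..q} - {j}. real i ^ 2 / \<bar>real i ^ 2 - real j ^ 2\<bar>)
    = 2 * fact q ^ 2 / (fact (q - j) * fact (q + j))"
  using assms(2)
proof (induction q rule: dec_induct)
  case base
  obtain k where k: "j = Suc k" using assms(1) by (cases j) auto
  have "{1..j} - {j} = {1..k}" using k by auto
  then have "(\<Prod>i\<in>{1..j} - {j}. real i ^ 2 / \<bar>real i ^ 2 - real j ^ 2\<bar>)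
    = fact k ^ 2 * fact j / (fact k * fact (j + k))"
    using prod_square_quotient_below[of k j] k by simp
  also have "\<dots> = 2 * fact j ^ 2 / (fact (j - j) * fact (j + j))"
    unfolding k add_Suc_right add_Suc fact_Suc
    by (simp add: divide_simps power2_eq_square)
  finally show ?case .
next
  case (step q)
  define d where "d = q - j"
  have d: "q = d + j" using step by (simp add: d_def)
  have s: "{1..Suc q} - {j} = insert (Suc q) ({1..q} - {j})" using step by auto
  have "real j ^ 2 < real (Suc q) ^ 2"
    using step by (intro power_strict_mono) auto
  then have e: "\<bar>real (Suc q) ^ 2 - real j ^ 2\<bar> = real (Suc d) * real (Suc q + j)"
    by (simp add: d power2_eq_square algebra_simps)
  have "(\<Prod>i\<in>{1..Suc q} - {j}. real i ^ 2 / \<bar>real i ^ 2 - real j ^ 2\<bar>)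
      = real (Suc q) ^ 2 / \<bar>real (Suc q) ^ 2 - real j ^ 2\<bar>
        * (\<Prod>i\<in>{1..q} - {j}. real i ^ 2 / \<bar>real i ^ 2 - real j ^ 2\<bar>)"
    unfolding s by (rule prod.insert) auto
  also have "\<dots> = real (Suc q) ^ 2 / (real (Suc d) * real (Suc q + j)) * (2 * fact q ^ 2 / (fact d * fact (q + j)))"
    unfolding e step.IH d_def ..
  also have "\<dots> = 2 * fact (Suc q) ^ 2 / (fact (Suc d) * fact (Suc q + j))"
    unfolding add_Suc fact_Suc by (simp add: divide_simps power2_eq_square)
  also have "Suc d = Suc q - j" using d by simp
  finally show ?case .
qed

text \<open>The central binomial coefficient is the largest, stated with denominators
  cleared.\<close>

lemma fact_square_le: "j \<le> q \<Longrightarrow> (fact q ^ 2 :: real) \<le> fact (q - j) * fact (q + j)"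
proof (induction j)
  case (Suc j)
  have d: "q - j = Suc (q - Suc j)" using Suc by simp
  have "(fact q ^ 2 :: real) \<le> fact (q - j) * fact (q + j)" using Suc by simp
  also have "\<dots> = fact (q - Suc j) * (real (q - j) * fact (q + j))"
    unfolding d fact_Suc by simp
  also have "\<dots> \<le> fact (q - Suc j) * (real (Suc (q + j)) * fact (q + j))"
    by (intro mult_left_mono mult_right_mono) auto
  finally show ?case by simp
qed (simp add: power2_eq_square)

lemma prod_square_quotient_le:
  assumes "1 \<le> j" and "j \<le> q"
  shows "(\<Prod>i\<in>{1..q} - {j}. real i ^ 2 / \<bar>real i ^ 2 - real j ^ 2\<bar>) \<le> 2"
  unfolding prod_square_quotient_eq[OF assms]
  using fact_square_le[OF assms(2)] by (simp add: divide_simps)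

text \<open>The term 1/q lets the induction close by telescoping.\<close>

lemma sum_inverse_squares_le:
  assumes "1 \<le> q"
  shows "(\<Sum>j\<in>{1..q}. 1 / real j ^ 2) \<le> 2 - 1 / real q"
  using assms
proof (induction q rule: dec_induct)
  case (step q)
  have "1 / real (Suc q) ^ 2 \<le> 1 / real q - 1 / real (Suc q)"
    using step by (simp add: divide_simps power2_eq_square)
  then show ?case using step by simp
qed simp


text \<open>The reciprocals approximate j^2/(N q^2), a quadratic grid in the interval from 0 to 1/N.
  The index j = q yields the node N itself, and smaller indices yield larger integers, so every node
  lies where the bounds are available.\<close>

definition quadratic_node :: "nat \<Rightarrow> nat \<Rightarrow> nat \<Rightarrow> nat" where
  "quadratic_node N q j = N * q ^ 2 div j ^ 2"

lemma quadratic_node_bounds: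
  shows "real (quadratic_node N q j) \<le> real N * real q ^ 2 / real j ^ 2"
    and "real N * real q ^ 2 / real j ^ 2 - 1 < real (quadratic_node N q j)"
proof -
  have e: "real N * real q ^ 2 / real j ^ 2 = real (N * q ^ 2) / real (j ^ 2)" by simp
  have "real (N * q ^ 2 div j ^ 2) = of_int \<lfloor>real (N * q ^ 2) / real (j ^ 2)\<rfloor>"
    by (simp only: floor_divide_of_nat_eq of_int_of_nat_eq)
  then show "real (quadratic_node N q j) \<le> real N * real q ^ 2 / real j ^ 2"
    and "real N * real q ^ 2 / real j ^ 2 - 1 < real (quadratic_node N q j)"
    unfolding e quadratic_node_def by linarith+
qed

lemma quadratic_node_ge:
  assumes "1 \<le> j" and "j \<le> q"
  shows "N \<le> quadratic_node N q j"
proof -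
  have "N * j ^ 2 \<le> N * q ^ 2"
    using assms by (intro mult_left_mono power_mono) auto
  then show ?thesis
    unfolding quadratic_node_def using assms by (simp add: less_eq_div_iff_mult_less_eq)
qed

text \<open>The exact ratios \<open>j\<^sup>2 / i\<^sup>2\<close> of the nodes \<open>N q\<^sup>2 / i\<^sup>2\<close> are perturbed by the rounding only by
  a factor \<open>1 - 1 / (2q)\<close>, which survives a product of \<open>q\<close> terms.\<close>
lemma quadratic_node_separation:
  assumes "1 \<le> i" "i \<le> q" "1 \<le> j" "j \<le> q" "i \<noteq> j" and N: "2 * q ^ 3 \<le> N"
  shows "(1 - 1 / (2 * real q)) * (\<bar>real i ^ 2 - real j ^ 2\<bar> / real i ^ 2)
    \<le> \<bar>1 - real (quadratic_node N q i) / real (quadratic_node N q j)\<bar>"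
proof -
  define a where "a i = real N * real q ^ 2 / real i ^ 2" for i
  let ?n = "\<lambda>i. real (quadratic_node N q i)"
  have "1 \<le> q ^ 3" using assms by simp
  then have N1: "1 \<le> N" using N by linarith
  have pos: "0 < ?n j" using quadratic_node_ge[of j q N] assms N1 by simp
  have a_pos: "0 < a j" using assms N1 by (simp add: a_def)
  have diff: "a i - a j = real N * real q ^ 2 * (real j ^ 2 - real i ^ 2) / (real i ^ 2 * real j ^ 2)"
    using assms by (simp add: a_def field_simps)
  have "real i ^ 2 \<noteq> real j ^ 2" using assms by simp
  then have "int i ^ 2 \<noteq> int j ^ 2"
    using assms by simp
  then have "1 \<le> \<bar>int j ^ 2 - int i ^ 2\<bar>" by linarith
  then have "(1::real) \<le> of_int \<bar>int j ^ 2 - int i ^ 2\<bar>" by linarith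
  then have one: "1 \<le> \<bar>real j ^ 2 - real i ^ 2\<bar>" by simp
  \<comment> \<open>Rounding moves a difference of two nodes by less than 1. This costs at most the
    proportion 1/(2q) once the exact gap is at least 2q, and distinct integer squares differing by
    at least 1 give that gap from 2 q^3 \<le> N.\<close>
  have "2 * real q * (real i ^ 2 * real j ^ 2) \<le> 2 * real q * (real q ^ 2 * real q ^ 2)"
    using assms by (intro mult_left_mono mult_mono power_mono) auto
  also have "\<dots> = 2 * real q ^ 3 * real q ^ 2" by (simp add: eval_nat_numeral)
  also have "\<dots> \<le> real N * real q ^ 2"
  proof -
    have "real (2 * q ^ 3) \<le> real N" using N by (simp only: of_nat_le_iff)
    then show ?thesis by (intro mult_right_mono) auto
  qed
  also have "\<dots> \<le> real N * real q ^ 2 * \<bar>real j ^ 2 - real i ^ 2\<bar>"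
    using one mult_left_mono[OF one, of "real N * real q ^ 2"] by simp
  finally have gap: "2 * real q \<le> \<bar>a i - a j\<bar>"
    unfolding diff using assms by (simp add: abs_mult divide_simps)
  have "(1 - 1 / (2 * real q)) * \<bar>a i - a j\<bar> = \<bar>a i - a j\<bar> - \<bar>a i - a j\<bar> / (2 * real q)"
    by (simp add: algebra_simps)
  also have "\<dots> \<le> \<bar>a i - a j\<bar> - 1"
  proof -
    have "1 \<le> \<bar>a i - a j\<bar> / (2 * real q)" using gap assms by (simp add: divide_simps)
    then show ?thesis by simp
  qed
  also have "\<dots> \<le> \<bar>?n j - ?n i\<bar>"
    using quadratic_node_bounds[of N q i] quadratic_node_bounds[of N q j] assms
    unfolding a_def by linarith
  finally have *: "(1 - 1 / (2 * real q)) * \<bar>a i - a j\<bar> \<le> \<bar>?n j - ?n i\<bar>" .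
  have "\<bar>real i ^ 2 - real j ^ 2\<bar> / real i ^ 2 = \<bar>a i - a j\<bar> / a j"
  proof -
    have cancel: "d / x = (c * d / (x * y)) / (c / y)" if "x \<noteq> 0" "y \<noteq> 0" "c \<noteq> 0" for c d x y :: real
      using that by (simp add: field_simps)
    have "\<bar>a i - a j\<bar> = real N * real q ^ 2 * \<bar>real i ^ 2 - real j ^ 2\<bar> / (real i ^ 2 * real j ^ 2)"
      unfolding diff by (simp add: abs_mult abs_minus_commute)
    then show ?thesis
      unfolding a_def[of j] using assms N1
      by (subst cancel[of "real i ^ 2" "real j ^ 2" "real N * real q ^ 2"]) (auto simp: a_def)
  qed
  then have "(1 - 1 / (2 * real q)) * (\<bar>real i ^ 2 - real j ^ 2\<bar> / real i ^ 2)
      = (1 - 1 / (2 * real q)) * \<bar>a i - a j\<bar> / a j" by simp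
  also have "\<dots> \<le> \<bar>?n j - ?n i\<bar> / a j"
    using * a_pos by (intro divide_right_mono) auto
  \<comment> \<open>Rounding down the denominator only enlarges the quotient.\<close>
  also have "\<dots> \<le> \<bar>?n j - ?n i\<bar> / ?n j"
    using quadratic_node_bounds(1)[of N q j] pos a_pos
    by (intro divide_left_mono mult_pos_pos) (auto simp: a_def)
  also have "\<dots> = \<bar>1 - ?n i / ?n j\<bar>"
    using pos by (simp add: divide_simps abs_if)
  finally show ?thesis .
qed

text \<open>A V. A. Markov type bound for all coefficients at once. Nodes that cluster quadratically at
  \<open>0\<close>, as the Chebyshev nodes do, keep the Lagrange basis bounded by an absolute constant.\<close>
theorem coeff_norm_le_reciprocal_bound:
  fixes P :: "complex poly"
  assumes q: "1 \<le> q" and N: "2 * q ^ 3 \<le> N" and deg: "Polynomial.degree P < q"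
    and bound: "\<And>n. N \<le> n \<Longrightarrow> cmod (poly P (1 / of_nat n)) \<le> B"
  shows "coeff_norm (1 / (2 * real N * real q ^ 2)) P \<le> 12 * real q * B"
proof -
  \<comment> \<open>With this radius \<open>s\<close> times the i-th node is at most 1/(2 i^2), so
    these products sum to at most 1 over all nodes.\<close>
  define s where "s = 1 / (2 * real N * real q ^ 2)"
  define a :: "nat \<Rightarrow> complex" where "a i = of_nat (quadratic_node N q i)" for i
  let ?I = "{1..q}"
  let ?n = "\<lambda>i. real (quadratic_node N q i)"
  have "1 \<le> q ^ 3" using q by simp
  then have N1: "1 \<le> N" using N by linarith
  have s0: "0 \<le> s" by (simp add: s_def)
  have half: "1 / 2 \<le> 1 - 1 / (2 * real q)" using q by (simp add: field_simps)
  have B0: "0 \<le> B" using bound[of N] norm_ge_zero order_trans by blast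
  have node_pos: "0 < ?n i" if "i \<in> ?I" for i
    using quadratic_node_ge[of i q N] that N1 by simp
  have sep_pos: "0 < (1 - 1 / (2 * real q)) * (\<bar>real i ^ 2 - real j ^ 2\<bar> / real i ^ 2)"
    if "i \<in> ?I" "j \<in> ?I" "i \<noteq> j" for i j
    using half that by (intro mult_pos_pos) auto
  have inj: "inj_on a ?I"
  proof (rule inj_onI, rule ccontr)
    fix i j assume ij: "i \<in> ?I" "j \<in> ?I" "a i = a j" "i \<noteq> j"
    then have "?n i = ?n j" by (simp add: a_def)
    then have "\<bar>1 - ?n i / ?n j\<bar> = 0" using node_pos[of j] ij by simp
    moreover have "0 < \<bar>1 - ?n i / ?n j\<bar>"
      using ij N by (intro less_le_trans[OF sep_pos quadratic_node_separation]) auto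
    ultimately show False by simp
  qed
  have basis: "coeff_norm s (lagrange_recip_basis a ?I j) \<le> 12" if j: "j \<in> ?I" for j
  proof -
    let ?J = "?I - {j}"
    have ca: "card ?J = q - 1" using j by simp
    have "coeff_norm s (lagrange_recip_basis a ?I j)
        \<le> (\<Prod>i\<in>?J. coeff_norm s (Polynomial.smult (inverse (1 - a i / a j)) [:1, - a i:]))"
      unfolding lagrange_recip_basis_def by (rule coeff_norm_prod[OF s0])
    also have "\<dots> \<le> (\<Prod>i\<in>?J. (1 / (1 - 1 / (2 * real q)) * (real i ^ 2 / \<bar>real i ^ 2 - real j ^ 2\<bar>))
        * exp (s * ?n i))"
    proof (rule prod_mono)
      fix i assume i: "i \<in> ?J"
      have "1 - a i / a j = of_real (1 - ?n i / ?n j)" by (simp add: a_def)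
      then have "cmod (1 - a i / a j) = \<bar>1 - ?n i / ?n j\<bar>" by (simp only: norm_of_real)
      then have "inverse (cmod (1 - a i / a j))
          \<le> inverse ((1 - 1 / (2 * real q)) * (\<bar>real i ^ 2 - real j ^ 2\<bar> / real i ^ 2))"
        using quadratic_node_separation[of i q j N] sep_pos[of i j] i j N
        by (intro le_imp_inverse_le) auto
      also have "\<dots> = 1 / (1 - 1 / (2 * real q)) * (real i ^ 2 / \<bar>real i ^ 2 - real j ^ 2\<bar>)"
        by (simp add: divide_simps)
      finally have inv_le: "inverse (cmod (1 - a i / a j))
        \<le> 1 / (1 - 1 / (2 * real q)) * (real i ^ 2 / \<bar>real i ^ 2 - real j ^ 2\<bar>)" (is "_ \<le> ?X") .
      have X0: "0 \<le> ?X" using half by (intro mult_nonneg_nonneg) auto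
      have factor: "coeff_norm s (Polynomial.smult (inverse (1 - a i / a j)) [:1, - a i:])
          = inverse (cmod (1 - a i / a j)) * (1 + s * ?n i)"
        unfolding coeff_norm_smult coeff_norm_pCons by (simp add: a_def norm_inverse)
      have "0 \<le> 1 + s * ?n i" using s0 by simp
      with inv_le X0 have "inverse (cmod (1 - a i / a j)) * (1 + s * ?n i) \<le> ?X * exp (s * ?n i)"
        by (intro mult_mono exp_ge_add_one_self) auto
      then show "0 \<le> coeff_norm s (Polynomial.smult (inverse (1 - a i / a j)) [:1, - a i:]) \<and>
        coeff_norm s (Polynomial.smult (inverse (1 - a i / a j)) [:1, - a i:]) \<le> ?X * exp (s * ?n i)"
        unfolding factor using \<open>0 \<le> 1 + s * ?n i\<close> by simp
    qed
    also have "\<dots> = (1 / (1 - 1 / (2 * real q))) ^ (q - 1)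
        * (\<Prod>i\<in>?J. real i ^ 2 / \<bar>real i ^ 2 - real j ^ 2\<bar>) * exp (\<Sum>i\<in>?J. s * ?n i)"
      unfolding prod.distrib exp_sum[OF finite_Diff[OF finite_atLeastAtMost]] prod_constant ca ..
    \<comment> \<open>The three factors are the rounding loss, handled by Bernoulli's inequality,
      the product at the exact nodes, and the bound e \<le> 3 for the exponential.\<close>
    also have "\<dots> \<le> 2 * 2 * 3"
    proof (intro mult_mono)
      have "1 / 2 \<le> 1 + real (q - 1) * (- (1 / (2 * real q)))"
        using q by (simp add: of_nat_diff field_simps)
      also have "\<dots> \<le> (1 + - (1 / (2 * real q))) ^ (q - 1)"
        using half by (intro Bernoulli_inequality) auto
      finally have "1 / 2 \<le> (1 - 1 / (2 * real q)) ^ (q - 1)" by simp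
      then show "(1 / (1 - 1 / (2 * real q))) ^ (q - 1) \<le> 2"
        using half by (simp add: power_divide divide_simps)
      show "(\<Prod>i\<in>?J. real i ^ 2 / \<bar>real i ^ 2 - real j ^ 2\<bar>) \<le> 2"
        using prod_square_quotient_le[of j q] j by simp
      have "(\<Sum>i\<in>?J. s * ?n i) \<le> (\<Sum>i\<in>?I. s * ?n i)"
        using s0 by (intro sum_mono2) auto
      also have "\<dots> \<le> (\<Sum>i\<in>?I. s * (real N * real q ^ 2 / real i ^ 2))"
        using s0 quadratic_node_bounds(1) by (intro sum_mono mult_left_mono) auto
      also have "\<dots> = 1 / 2 * (\<Sum>i\<in>?I. 1 / real i ^ 2)"
        unfolding sum_distrib_left using N1 q by (intro sum.cong) (auto simp: s_def)
      also have "\<dots> \<le> 1 / 2 * 2"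
      proof -
        have "(\<Sum>i\<in>?I. 1 / real i ^ 2) \<le> 2 - 1 / real q" by (rule sum_inverse_squares_le[OF q])
        also have "\<dots> \<le> 2" by simp
        finally show ?thesis by simp
      qed
      finally have "exp (\<Sum>i\<in>?J. s * ?n i) \<le> exp 1" by simp
      then show "exp (\<Sum>i\<in>?J. s * ?n i) \<le> 3" using exp_le by linarith
    qed (use half in \<open>auto intro!: prod_nonneg\<close>)
    finally show ?thesis by simp
  qed
  have "P = (\<Sum>j\<in>?I. Polynomial.smult (poly P (1 / a j)) (lagrange_recip_basis a ?I j))"
    by (rule lagrange_recip_interpolation[OF _ inj]) (use deg node_pos in \<open>auto simp: a_def\<close>)
  then have "coeff_norm s P \<le> (\<Sum>j\<in>?I. coeff_norm s (Polynomial.smult (poly P (1 / a j)) (lagrange_recip_basis a ?I j)))"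
    using coeff_norm_sum[OF s0] by metis
  also have "\<dots> \<le> (\<Sum>j\<in>?I. B * 12)"
  proof (rule sum_mono)
    fix j assume j: "j \<in> ?I"
    have "cmod (poly P (1 / a j)) \<le> B"
      unfolding a_def by (rule bound) (use j quadratic_node_ge in auto)
    then show "coeff_norm s (Polynomial.smult (poly P (1 / a j)) (lagrange_recip_basis a ?I j)) \<le> B * 12"
      unfolding coeff_norm_smult using basis[OF j] B0 s0 by (intro mult_mono coeff_norm_nonneg) auto
  qed
  finally show ?thesis by (simp add: s_def mult_ac)
qed

section \<open>Separating polynomials and asymptotic moments\<close>

text \<open>The truncated expansion is a polynomial \<open>P\<close> in 1/n. For n \<ge> N it
  differs from \<open>E n\<close> by at most 1, so interpolation bounds the sum of |U k| s^k by 12 q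
  (H + 1). Writing 1/n = t s with t \<le> 1, every term with k \<ge> 2 gains the factor t^2.\<close>

lemma first_order_expansion_error:
  fixes U E :: "nat \<Rightarrow> complex"
  assumes q: "2 \<le> q" and N: "2 * q ^ 3 \<le> N"
    and expansion: "\<And>n. N \<le> n \<Longrightarrow> cmod (E n - (\<Sum>k<q. U k / of_nat n ^ k)) \<le> (real N / real n) ^ q"
    and bound: "\<And>n. N \<le> n \<Longrightarrow> cmod (E n) \<le> H"
    and n: "2 * N * q ^ 2 \<le> n"
  shows "cmod (E n - U 0 - U 1 / of_nat n)
    \<le> (real N / real n) ^ q + (2 * real N * real q ^ 2 / real n) ^ 2 * (12 * real q * (H + 1))"
proof -
  define P where "P = (\<Sum>k<q. Polynomial.monom (U k) k)"
  define s where "s = 1 / (2 * real N * real q ^ 2)"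
  have "1 \<le> q ^ 3" using q by simp
  then have N1: "1 \<le> N" using N by linarith
  have Nn: "N \<le> n"
  proof -
    have "1 \<le> q ^ 2" using q by simp
    then have "N * 1 \<le> N * (2 * q ^ 2)" by (intro mult_le_mono2) linarith
    also have "\<dots> \<le> n" using n by (simp only: mult_ac)
    finally show ?thesis by simp
  qed
  have n1: "1 \<le> n" using N1 Nn by simp
  have s: "0 < s" using N1 q by (simp add: s_def)
  have coeff_P: "coeff P k = (if k < q then U k else 0)" for k
    by (simp add: P_def coeff_sum)
  have "Polynomial.degree P \<le> q - 1"
    by (rule degree_le) (use q in \<open>auto simp: coeff_P\<close>)
  then have deg: "Polynomial.degree P < q" using q by simp
  have P_eval: "poly P (1 / of_nat n) = (\<Sum>k<q. U k / of_nat n ^ k)" for n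
    by (simp add: P_def poly_sum poly_monom power_divide)
  have H0: "0 \<le> H" using bound[of N] norm_ge_zero order_trans by blast
  have "coeff_norm (1 / (2 * real N * real q ^ 2)) P \<le> 12 * real q * (H + 1)"
  proof (rule coeff_norm_le_reciprocal_bound[OF _ N deg])
    fix n assume n: "N \<le> n"
    have "(real N / real n) ^ q \<le> 1"
      using n by (intro power_le_one) (auto simp: divide_simps)
    moreover have "cmod (poly P (1 / of_nat n)) \<le> cmod (E n) + cmod (E n - poly P (1 / of_nat n))"
      by (metis norm_minus_commute norm_triangle_sub)
    ultimately show "cmod (poly P (1 / of_nat n)) \<le> H + 1"
      using expansion[OF n] bound[OF n] unfolding P_eval by linarith
  qed (use q in simp)
  then have "(\<Sum>k\<le>q - 1. cmod (coeff P k) * s ^ k) \<le> 12 * real q * (H + 1)"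
    unfolding s_def using deg by (subst (asm) coeff_norm_eq_sum[of _ "q - 1"]) auto
  moreover have "{..q - 1} = {..<q}" using q by auto
  ultimately have cn: "(\<Sum>k<q. cmod (U k) * s ^ k) \<le> 12 * real q * (H + 1)"
    by (simp add: coeff_P)
  define t where "t = 1 / (real n * s)"
  have t_eq: "t = 2 * real N * real q ^ 2 / real n" by (simp add: t_def s_def)
  have "real (2 * N * q ^ 2) \<le> real n" using n by (simp only: of_nat_le_iff)
  then have t: "0 \<le> t" "t \<le> 1" using n1 by (auto simp: t_eq divide_simps)
  have "{..<q} = insert 0 (insert 1 {2..<q})" using q by auto
  then have split: "(\<Sum>k<q. U k / of_nat n ^ k) = U 0 + U 1 / of_nat n + (\<Sum>k\<in>{2..<q}. U k / of_nat n ^ k)"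
    by simp
  have "cmod (\<Sum>k\<in>{2..<q}. U k / of_nat n ^ k) \<le> (\<Sum>k\<in>{2..<q}. t ^ 2 * (cmod (U k) * s ^ k))"
  proof (rule order_trans[OF norm_sum sum_mono])
    fix k assume k: "k \<in> {2..<q}"
    have "1 / real n = t * s" using s n1 by (simp add: t_def)
    then have "cmod (U k / of_nat n ^ k) = cmod (U k) * (t * s) ^ k"
      by (metis norm_divide norm_power norm_of_nat divide_inverse power_inverse inverse_eq_divide)
    also have "\<dots> = t ^ k * (cmod (U k) * s ^ k)" by (simp add: power_mult_distrib)
    also have "\<dots> \<le> t ^ 2 * (cmod (U k) * s ^ k)"
      using k t s by (intro mult_right_mono power_decreasing) auto
    finally show "cmod (U k / of_nat n ^ k) \<le> t ^ 2 * (cmod (U k) * s ^ k)" .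
  qed
  also have "\<dots> = t ^ 2 * (\<Sum>k\<in>{2..<q}. cmod (U k) * s ^ k)" by (simp add: sum_distrib_left)
  also have "\<dots> \<le> t ^ 2 * (\<Sum>k<q. cmod (U k) * s ^ k)"
    using s by (intro mult_left_mono sum_mono2) auto
  also have "\<dots> \<le> t ^ 2 * (12 * real q * (H + 1))" using cn by (intro mult_left_mono) auto
  finally have tail: "cmod (\<Sum>k\<in>{2..<q}. U k / of_nat n ^ k) \<le> t ^ 2 * (12 * real q * (H + 1))" .
  have "E n - U 0 - U 1 / of_nat n = (E n - (\<Sum>k<q. U k / of_nat n ^ k)) + (\<Sum>k\<in>{2..<q}. U k / of_nat n ^ k)"
    unfolding split by simp
  then have "cmod (E n - U 0 - U 1 / of_nat n)
      \<le> cmod (E n - (\<Sum>k<q. U k / of_nat n ^ k)) + cmod (\<Sum>k\<in>{2..<q}. U k / of_nat n ^ k)"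
    by (simp only: norm_triangle_ineq)
  then show ?thesis using expansion[OF Nn] tail unfolding t_eq by linarith
qed

text \<open>The monomial W = (t/K)^M is at least 1/\<beta> beyond r', and at most about 1/\<beta>
  times (r/r')^M in coefficient norm at r. Replacing W by 1 - (1 - W)^N with N comparable to \<beta>
  amplifies it to at least 1/2 beyond r', keeps it between 0 and 1 on [0, K], and multiplies the
  coefficient norm by little more than N. The final factor 2 raises 1/2 to 1.\<close>

lemma separating_polynomial:
  fixes r r' K :: real
  assumes "0 < r" "r < r'" "r' \<le> K"
  obtains g :: "real poly" where "coeff_norm r g \<le> 1 / 16"
    and "\<And>t. 0 \<le> t \<Longrightarrow> t \<le> K \<Longrightarrow> 0 \<le> poly g t \<and> poly g t \<le> 2"
    and "\<And>t. r' \<le> t \<Longrightarrow> t \<le> K \<Longrightarrow> 1 \<le> poly g t"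
proof -
  \<comment> \<open>The number 1/128 passes through N \<le> 2 \<beta>, exp z - 1 \<le> 2 z and the
    factor 2 in \<open>g\<close>, each of which doubles it, and ends as 1/16.\<close>
  obtain M where M: "(r / r') ^ M < 1 / 128"
    using real_arch_pow_inv[of "1 / 128" "r / r'"] assms by auto
  define \<beta> where "\<beta> = (K / r') ^ M"
  define N where "N = nat \<lceil>\<beta>\<rceil>"
  define W :: "real poly" where "W = Polynomial.monom (1 / K ^ M) M"
  define g where "g = Polynomial.smult 2 (1 - (1 - W) ^ N)"
  define w where "w = (r / K) ^ M"
  have \<beta>: "1 \<le> \<beta>" unfolding \<beta>_def using assms by (intro one_le_power) (auto simp: divide_simps)
  have N: "\<beta> \<le> real N" "real N \<le> 2 * \<beta>" using \<beta> unfolding N_def by linarith+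
  have w0: "0 \<le> w" using assms by (simp add: w_def)
  have W_eval: "poly W t = (t / K) ^ M" for t by (simp add: W_def poly_monom power_divide)
  have "\<beta> * w = (r / r') ^ M"
    unfolding \<beta>_def w_def power_mult_distrib[symmetric] using assms by simp
  then have Nw: "real N * w \<le> 1 / 64" using mult_right_mono[OF N(2) w0] M by simp
  show thesis
  proof (rule that)
    have r0: "0 \<le> r" using assms by simp
    \<comment> \<open>Factoring out W cancels the constant term before absolute values are taken; a
      direct triangle inequality would leave a norm of at least 1.\<close>
    have "1 - (1 - W) ^ N = W * (\<Sum>i<N. (1 - W) ^ i)" using one_diff_power_eq[of "1 - W" N] by simp
    then have "coeff_norm r (1 - (1 - W) ^ N) \<le> coeff_norm r W * coeff_norm r (\<Sum>i<N. (1 - W) ^ i)"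
      using coeff_norm_mult[OF r0] by simp
    also have "\<dots> \<le> coeff_norm r W * (\<Sum>i<N. coeff_norm r ((1 - W) ^ i))"
      by (intro mult_left_mono coeff_norm_sum coeff_norm_nonneg r0)
    also have "\<dots> \<le> w * (\<Sum>i<N. (1 + w) ^ i)"
    proof (intro mult_mono sum_mono)
      show W_norm: "coeff_norm r W \<le> w" unfolding W_def coeff_norm_monom w_def
        using assms by (simp add: power_divide)
      have "coeff_norm r (1 + - W) \<le> coeff_norm r (1 :: real poly) + coeff_norm r (- W)"
        by (rule coeff_norm_add) (rule r0)
      then have "coeff_norm r (1 - W) \<le> 1 + w" using W_norm by simp
      then show "coeff_norm r ((1 - W) ^ i) \<le> (1 + w) ^ i" for i
        using coeff_norm_power[OF r0] power_mono[OF _ coeff_norm_nonneg[OF r0]] order_trans by blast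
    qed (use w0 coeff_norm_nonneg[OF r0] in \<open>auto intro!: sum_nonneg\<close>)
    also have "\<dots> = (1 + w) ^ N - 1" using power_diff_1_eq[of "1 + w" N] by simp
    also have "\<dots> \<le> exp (real N * w) - 1"
      using power_mono[OF exp_ge_add_one_self[of w], of N] w0 by (simp add: exp_of_nat_mult)
    also have "\<dots> \<le> 2 * (real N * w)"
    proof -
      have "0 \<le> real N * w" using w0 by simp
      then have "exp (real N * w) \<le> 1 + real N * w + (real N * w) ^ 2" using Nw by (intro exp_bound) auto
      moreover have "(real N * w) ^ 2 \<le> real N * w"
        using \<open>0 \<le> real N * w\<close> Nw by (simp add: power2_eq_square mult_left_le)
      ultimately show ?thesis by simp
    qed
    finally show "coeff_norm r g \<le> 1 / 16" unfolding g_def using Nw by simp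
  next
    fix t assume t: "0 \<le> t" "t \<le> K"
    have "0 \<le> poly W t" "poly W t \<le> 1"
      unfolding W_eval using t assms by (auto intro!: power_le_one)
    then have "0 \<le> (1 - poly W t) ^ N" "(1 - poly W t) ^ N \<le> 1" by (auto intro!: power_le_one)
    then show "0 \<le> poly g t \<and> poly g t \<le> 2" by (simp add: g_def)
  next
    fix t assume t: "r' \<le> t" "t \<le> K"
    have "(r' / K) ^ M \<le> poly W t"
      unfolding W_eval using t assms by (intro power_mono divide_right_mono) auto
    then have W_ge: "1 / \<beta> \<le> poly W t" by (simp add: \<beta>_def power_divide)
    have "poly W t \<le> 1" unfolding W_eval using t assms by (intro power_le_one) auto
    then have "(1 - poly W t) ^ N \<le> exp (- (1 / \<beta>)) ^ N"
      using W_ge exp_ge_add_one_self[of "- (1 / \<beta>)"] by (intro power_mono) auto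
    also have "\<dots> = exp (- (real N / \<beta>))" by (simp add: exp_of_nat_mult[symmetric])
    also have "\<dots> \<le> exp (- 1)" using N \<beta> by (simp add: divide_simps)
    also have "\<dots> \<le> 1 / 2" using exp_ge_add_one_self[of 1] by (simp add: exp_minus divide_simps)
    finally show "1 \<le> poly g t" by (simp add: g_def)
  qed
qed

text \<open>The linear functional on polynomials that sends X^i to \<open>a i\<close>. For moments
  of y it stands for the functional evaluated at h(y), without forming h(y) in the group
  algebra.\<close>

definition moment :: "(nat \<Rightarrow> complex) \<Rightarrow> real poly \<Rightarrow> complex" where
  "moment a h = (\<Sum>i\<le>Polynomial.degree h. complex_of_real (coeff h i) * a i)"

text \<open>The radius s is the growth rate of the sequence: below it is K for the expansion error
  and r for the two leading terms.\<close>

lemma norm_moment_le: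
  assumes "\<And>i. i \<le> Polynomial.degree h \<Longrightarrow> cmod (a i) \<le> c * s ^ i"
  shows "cmod (moment a h) \<le> c * coeff_norm s h"
proof -
  have "cmod (moment a h) \<le> (\<Sum>i\<le>Polynomial.degree h. \<bar>coeff h i\<bar> * cmod (a i))"
    unfolding moment_def by (rule order_trans[OF norm_sum]) (simp add: norm_mult)
  also have "\<dots> \<le> (\<Sum>i\<le>Polynomial.degree h. \<bar>coeff h i\<bar> * (c * s ^ i))"
    using assms by (intro sum_mono mult_left_mono) auto
  also have "\<dots> = c * coeff_norm s h"
    by (simp add: coeff_norm_eq_sum[OF order_refl] sum_distrib_left mult_ac)
  finally show ?thesis .
qed

lemma moment_diff: "moment (\<lambda>i. a i - b i) h = moment a h - moment b h"
  by (simp add: moment_def right_diff_distrib sum_subtractf)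

lemma moment_sum: "moment (\<lambda>i. \<Sum>k\<in>I. b k i / c k) h = (\<Sum>k\<in>I. moment (b k) h / c k)"
  unfolding moment_def sum_distrib_left sum_divide_distrib by (subst sum.swap) simp

text \<open>The test polynomial is \<open>g ^ m\<close> with \<open>4 ^ m \<approx> n\<close>: then \<open>n * 16 ^ (- m)\<close> and
  \<open>2 ^ m / n\<close> are both negligible, the latter even after multiplication by powers of \<open>m\<close>.\<close>
theorem separating_moments_tendsto_0:
  fixes a v :: "nat \<Rightarrow> nat \<Rightarrow> complex"
  assumes r: "0 < r" "r < r'" "r' \<le> K" and C: "1 \<le> C"
    and expansion: "\<And>q n p. 1 \<le> q \<Longrightarrow> 1 \<le> n \<Longrightarrow> p * R \<le> q \<Longrightarrow> C * real q powr C \<le> real n \<Longrightarrow>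
      cmod (a n p - (\<Sum>k<q. v k p / of_nat n ^ k)) \<le> K ^ p * ((C * real q) powr (C * real q) / real n ^ q)"
    and v0: "\<And>p. cmod (v 0 p) \<le> r ^ p" and v1: "\<And>p. cmod (v 1 p) \<le> C1 * r ^ p"
    and bound: "\<And>n h b. 1 \<le> n \<Longrightarrow> (\<And>t. 0 \<le> t \<Longrightarrow> t \<le> K \<Longrightarrow> \<bar>poly h t\<bar> \<le> b) \<Longrightarrow> cmod (moment (a n) h) \<le> b"
  obtains h :: "nat \<Rightarrow> real poly" where "\<And>n t. 0 \<le> t \<Longrightarrow> t \<le> K \<Longrightarrow> 0 \<le> poly (h n) t"
    and "\<And>n t. r' \<le> t \<Longrightarrow> t \<le> K \<Longrightarrow> 1 \<le> poly (h n) t"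
    and "(\<lambda>n. real n * cmod (moment (a n) (h n))) \<longlonglongrightarrow> 0"
proof -
  obtain g :: "real poly" where g: "coeff_norm r g \<le> 1 / 16"
    "\<And>t. 0 \<le> t \<Longrightarrow> t \<le> K \<Longrightarrow> 0 \<le> poly g t \<and> poly g t \<le> 2"
    "\<And>t. r' \<le> t \<Longrightarrow> t \<le> K \<Longrightarrow> 1 \<le> poly g t"
    using separating_polynomial[OF r] by blast
  \<comment> \<open>The index q will be D * m. The product term makes q at least R times the degree
    of g^m, so the expansion holds for every moment involved; the summand 4 gives q \<ge> 4.\<close>
  define D where "D = R * Polynomial.degree g + 4"
  define A where "A = max 1 (coeff_norm K g)"
  define c where "c = nat \<lceil>C\<rceil>"
  \<comment> \<open>With q = D * m, the first summand absorbs both the error constant of the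
    expansion and the coefficient norm of g^m at K; the second meets the requirement of the
    interpolation. Only polynomial growth in m matters.\<close>
  define N where "N m = nat \<lceil>A * (C * real (D * m)) ^ c\<rceil> + 2 * (D * m) ^ 3" for m
  \<comment> \<open>In the first term, 4, C1 and 1 come from the orders zero and one and from the
    truncation error; the second term bounds all orders from two on.\<close>
  define F where "F m = (4 + C1 + 1) / 4 ^ m + 96 * (real (N m) ^ 2 * real (D * m) ^ 5 / 2 ^ m)" for m
  have r0: "0 \<le> r" and K0: "0 \<le> K" using r by auto
  have A: "1 \<le> A" "coeff_norm K g \<le> A" by (auto simp: A_def)
  have D: "4 \<le> D" by (simp add: D_def)
  have C1: "0 \<le> C1" using order_trans[OF norm_ge_zero v1[of 0]] by simp

  have estimate: "real n * cmod (moment (a n) (g ^ m)) \<le> F m"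
    if m: "1 \<le> m" "4 ^ m \<le> n" "n < 4 * 4 ^ m" and small: "real (N m) ^ 2 * real (D * m) ^ 5 / 2 ^ m \<le> 1 / 2"
    for n m :: nat
  proof -
    define q where "q = D * m"
    let ?N = "N m" and ?h = "g ^ m"
    have q: "4 \<le> q" unfolding q_def using mult_le_mono[OF D m(1)] by simp
    have N_cube: "2 * q ^ 3 \<le> ?N" by (simp add: N_def q_def)
    have N_powr: "A * (C * real q) powr C \<le> real ?N"
    proof -
      have "1 * 1 \<le> C * real q" using C q by (intro mult_mono) auto
      then have "(C * real q) powr C \<le> (C * real q) powr real c"
        unfolding c_def by (intro powr_mono real_nat_ceiling_ge) auto
      also have "\<dots> = (C * real q) ^ c" using C q by (simp add: powr_realpow)
      finally have "A * (C * real q) powr C \<le> A * (C * real q) ^ c" using A(1) by (intro mult_left_mono) auto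
      then show ?thesis unfolding N_def q_def by linarith
    qed
    have "1 \<le> q ^ 3" using q by simp
    then have N1: "1 \<le> ?N" using N_cube by linarith
    have "(1::nat) \<le> 4 ^ m" by simp
    then have n1: "1 \<le> n" using m(2) by linarith
    have deg: "p * R \<le> q" if "p \<le> Polynomial.degree ?h" for p
    proof -
      have "p * R \<le> (Polynomial.degree g * m) * R"
        using that degree_power_le[of g m] by (intro mult_le_mono1) simp
      also have "\<dots> \<le> q" by (simp add: q_def D_def algebra_simps)
      finally show ?thesis .
    qed
    have err: "cmod (moment (a n') ?h - (\<Sum>k<q. moment (v k) ?h / of_nat n' ^ k)) \<le> (real ?N / real n') ^ q"
      if n': "?N \<le> n'" for n'
    proof -
      let ?e = "(C * real q) powr (C * real q) / real n' ^ q"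
      have n'1: "1 \<le> n'" using N1 n' by simp
      have "C * real q powr C \<le> A * (C * real q) powr C"
      proof -
        have "C * real q powr C \<le> C powr C * real q powr C"
          using C powr_mono[of 1 C C] by (intro mult_right_mono) auto
        also have "\<dots> = (C * real q) powr C" using C by (simp add: powr_mult)
        also have "\<dots> \<le> A * (C * real q) powr C" using A(1) mult_right_mono[of 1 A "(C * real q) powr C"] by simp
        finally show ?thesis .
      qed
      also have "\<dots> \<le> real n'" using N_powr n' by linarith
      finally have large: "C * real q powr C \<le> real n'" .
      have "moment (a n') ?h - (\<Sum>k<q. moment (v k) ?h / of_nat n' ^ k)
          = moment (\<lambda>p. a n' p - (\<Sum>k<q. v k p / of_nat n' ^ k)) ?h"
        by (simp add: moment_diff moment_sum)
      also have "cmod \<dots> \<le> ?e * coeff_norm K ?h"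
        using expansion[OF _ n'1 deg large] q by (intro norm_moment_le) (simp add: mult.commute)
      also have "\<dots> \<le> ?e * A ^ q"
      proof (rule mult_left_mono)
        have "coeff_norm K ?h \<le> A ^ m"
          using coeff_norm_power[OF K0] power_mono[OF A(2) coeff_norm_nonneg[OF K0]] order_trans by blast
        also have "\<dots> \<le> A ^ q" using A(1) D by (intro power_increasing) (auto simp: q_def)
        finally show "coeff_norm K ?h \<le> A ^ q" .
      qed simp
      \<comment> \<open>The exponent C q turns the error constant into a q-th power, so the whole
        error is a q-th power of something polynomial in q over n'.\<close>
      also have "\<dots> = (A * (C * real q) powr C) ^ q / real n' ^ q"
        using C q by (simp add: power_mult_distrib powr_powr[symmetric] powr_realpow)
      also have "\<dots> \<le> real ?N ^ q / real n' ^ q"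
        using N_powr A(1) by (intro divide_right_mono power_mono) auto
      finally show ?thesis by (simp add: power_divide)
    qed
    have bnd: "cmod (moment (a n') ?h) \<le> 2 ^ m" if "?N \<le> n'" for n'
      using N1 that g(2) by (intro bound) (auto simp: abs_of_nonneg intro!: power_mono)
    have half: "2 * (real ?N ^ 2 * real q ^ 5) \<le> 2 ^ m" using small by (simp add: q_def field_simps)
    have two: "(2::real) ^ m * 2 ^ m = 4 ^ m" by (simp add: power_mult_distrib[symmetric])
    have "real (4 ^ m) \<le> real n" and "real n \<le> real (4 * 4 ^ m)"
      using m(2,3) by (simp_all only: of_nat_le_iff)
    then have n4: "(4::real) ^ m \<le> real n" and n4': "real n \<le> 4 * 4 ^ m" by simp_all
    \<comment> \<open>Both follow from 2 N^2 q^5 \<le> 2^m \<le> n.\<close>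
    have "real (?N ^ 2) \<le> real n" and "real (2 * ?N * q ^ 2) \<le> real n"
    proof -
      have "(2::real) ^ m * 1 \<le> 2 ^ m * 2 ^ m" by (intro mult_left_mono) auto
      then have 2: "(2::real) ^ m \<le> real n" using n4 unfolding two by linarith
      have "real ?N ^ 2 * 1 \<le> real ?N ^ 2 * real q ^ 5" using q by (intro mult_left_mono) auto
      also have "\<dots> \<le> 2 * (real ?N ^ 2 * real q ^ 5)" by simp
      finally have "real ?N ^ 2 \<le> real n" using half 2 by linarith
      then show "real (?N ^ 2) \<le> real n" by simp
      have "real ?N * real q ^ 2 \<le> real ?N ^ 2 * real q ^ 5"
        using N1 q by (intro mult_mono power_increasing self_le_power) auto
      then have "2 * (real ?N * real q ^ 2) \<le> real n" using half 2 by linarith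
      then show "real (2 * ?N * q ^ 2) \<le> real n" by (simp add: mult.assoc)
    qed
    then have Nsq: "?N ^ 2 \<le> n" and Nq: "2 * ?N * q ^ 2 \<le> n" by (simp_all only: of_nat_le_iff)
    have "cmod (moment (a n) ?h - moment (v 0) ?h - moment (v 1) ?h / of_nat n)
      \<le> (real ?N / real n) ^ q + (2 * real ?N * real q ^ 2 / real n) ^ 2 * (12 * real q * (2 ^ m + 1))"
      using q by (intro first_order_expansion_error[where E = "\<lambda>n. moment (a n) ?h" and U = "\<lambda>k. moment (v k) ?h"]
        N_cube err bnd Nq) auto
    \<comment> \<open>Here q \<ge> 4 and N^2 \<le> n enter: (N/n)^4 = (N^2/n)^2 / n^2.\<close>
    moreover have "(real ?N / real n) ^ q \<le> 1 / real n ^ 2"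
    proof -
      have "?N \<le> n" using Nsq self_le_power[OF N1, of 2] by linarith
      then have "(real ?N / real n) ^ q \<le> (real ?N / real n) ^ 4"
        using q by (intro power_decreasing) (auto simp: divide_simps)
      also have "\<dots> = (real ?N ^ 2 / real n) ^ 2 / real n ^ 2" using n1 by (simp add: power_divide field_simps)
      also have "\<dots> \<le> 1 / real n ^ 2"
        using Nsq n1 by (intro divide_right_mono power_le_one)
          (auto simp: divide_simps simp flip: of_nat_power)
      finally show ?thesis .
    qed
    moreover have "(2 * real ?N * real q ^ 2 / real n) ^ 2 * (12 * real q * (2 ^ m + 1))
        \<le> 96 * (real ?N ^ 2 * real q ^ 5 * 2 ^ m) / real n ^ 2"
    proof -
      have "(2::real) ^ m + 1 \<le> 2 * 2 ^ m" by simp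
      then have "(2 * real ?N * real q ^ 2 / real n) ^ 2 * (12 * real q * (2 ^ m + 1))
          \<le> (2 * real ?N * real q ^ 2 / real n) ^ 2 * (12 * real q * (2 * 2 ^ m))"
        by (intro mult_left_mono) auto
      also have "\<dots> = 96 * (real ?N ^ 2 * real q ^ 5 * 2 ^ m) / real n ^ 2"
        by (simp add: power_divide power_mult_distrib eval_nat_numeral)
      finally show ?thesis .
    qed
    moreover have hr: "coeff_norm r ?h \<le> (1 / 16) ^ m"
      using coeff_norm_power[OF r0] power_mono[OF g(1) coeff_norm_nonneg[OF r0]] order_trans by blast
    moreover have "cmod (moment (v 0) ?h) \<le> 1 * coeff_norm r ?h"
      using v0 by (intro norm_moment_le) simp
    moreover have "cmod (moment (v 1) ?h / of_nat n) \<le> C1 * (1 / 16) ^ m / real n"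
    proof -
      have "cmod (moment (v 1) ?h) \<le> C1 * coeff_norm r ?h" by (rule norm_moment_le) (rule v1)
      also have "\<dots> \<le> C1 * (1 / 16) ^ m" by (rule mult_left_mono[OF hr C1])
      finally show ?thesis by (simp add: norm_divide divide_right_mono)
    qed
    moreover have "cmod (moment (a n) ?h) \<le> cmod (moment (a n) ?h - moment (v 0) ?h - moment (v 1) ?h / of_nat n)
        + cmod (moment (v 0) ?h) + cmod (moment (v 1) ?h / of_nat n)"
    proof -
      have "cmod (x - y - z + y + z) \<le> cmod (x - y - z) + cmod y + cmod z" for x y z :: complex
        by (intro norm_triangle_mono order_refl)
      then show ?thesis by simp
    qed
    ultimately have "cmod (moment (a n) ?h) \<le> (1 / 16) ^ m + C1 * (1 / 16) ^ m / real n
        + 1 / real n ^ 2 + 96 * (real ?N ^ 2 * real q ^ 5 * 2 ^ m) / real n ^ 2"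
      by linarith
    then have "real n * cmod (moment (a n) ?h) \<le> real n * ((1 / 16) ^ m + C1 * (1 / 16) ^ m / real n
        + 1 / real n ^ 2 + 96 * (real ?N ^ 2 * real q ^ 5 * 2 ^ m) / real n ^ 2)"
      by (intro mult_left_mono) auto
    also have "\<dots> = real n * (1 / 16) ^ m + C1 * (1 / 16) ^ m + 1 / real n
        + 96 * (real ?N ^ 2 * real q ^ 5) * 2 ^ m / real n"
      using n1 by (simp add: field_simps power2_eq_square)
    \<comment> \<open>The upper bound on n is used only in the order zero term, where n stands in
      the numerator; elsewhere n is replaced by its lower bound 4^m.\<close>
    also have "\<dots> \<le> (4 * 4 ^ m) * (1 / 16) ^ m + C1 * (1 / 4) ^ m + 1 / 4 ^ m
        + 96 * (real ?N ^ 2 * real q ^ 5) * 2 ^ m / 4 ^ m"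
      using n4 n4' C1 n1 by (intro add_mono mult_right_mono mult_left_mono divide_left_mono power_mono) auto
    also have "\<dots> = F m"
    proof -
      have "(4::real) ^ m * (1 / 16) ^ m = (1 / 4) ^ m" by (simp add: power_mult_distrib[symmetric])
      moreover have "(2::real) ^ m / 4 ^ m = 1 / 2 ^ m"
        unfolding power_divide[symmetric] by (simp add: power_one_over)
      ultimately show ?thesis
        unfolding F_def q_def[symmetric] times_divide_eq_right[symmetric]
        by (simp add: power_one_over add_divide_distrib algebra_simps)
    qed
    finally show ?thesis .
  qed

  have decay: "(\<lambda>m. real (N m) ^ 2 * real (D * m) ^ 5 / 2 ^ m) \<longlonglongrightarrow> 0"
  proof (rule tendsto_sandwich[OF always_eventually always_eventually tendsto_const])
    \<comment> \<open>The exponent c + 3 dominates both c and 3, so N m is at most B (D m)^(c+3),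
      and k is the resulting total degree in m.\<close>
    define B where "B = A * C ^ c + 3"
    define k where "k = 2 * (c + 3) + 5"
    have exp_ln2: "exp (real m * ln 2) = (2::real) ^ m" for m by (simp add: exp_of_nat_mult)
    have "(\<lambda>m. (B ^ 2 * real D ^ k / ln 2 ^ k) * ((real m * ln 2) ^ k / exp (real m * ln 2))) \<longlonglongrightarrow> B ^ 2 * real D ^ k / ln 2 ^ k * 0"
      by (intro tendsto_mult_left filterlim_compose[OF tendsto_power_div_exp_0]) real_asymp
    then show "(\<lambda>m. B ^ 2 * real D ^ k * real m ^ k / 2 ^ m) \<longlonglongrightarrow> 0"
      unfolding exp_ln2 power_mult_distrib by (simp add: mult_ac)
    show "\<forall>m. real (N m) ^ 2 * real (D * m) ^ 5 / 2 ^ m \<le> B ^ 2 * real D ^ k * real m ^ k / 2 ^ m"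
    proof
      fix m
      define q where "q = D * m"
      show "real (N m) ^ 2 * real (D * m) ^ 5 / 2 ^ m \<le> B ^ 2 * real D ^ k * real m ^ k / 2 ^ m"
      proof (cases "q = 0")
        case True
        have "(0::real) \<le> B ^ 2 * real D ^ k * real m ^ k / 2 ^ m" by simp
        then show ?thesis using True unfolding q_def by auto
      next
        case False
        then have q1: "1 \<le> real q" by simp
        have "0 \<le> A * (C * real q) ^ c" using A C by simp
        then have "real (N m) \<le> A * (C * real q) ^ c + 1 + 2 * real q ^ 3"
          unfolding N_def q_def[symmetric] by simp
        also have "\<dots> = A * C ^ c * real q ^ c + 1 + 2 * real q ^ 3" by (simp add: power_mult_distrib)
        also have "\<dots> \<le> A * C ^ c * real q ^ (c + 3) + real q ^ (c + 3) + 2 * real q ^ (c + 3)"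
          using q1 A C by (intro add_mono mult_left_mono power_increasing one_le_power) auto
        also have "\<dots> = B * real q ^ (c + 3)" by (simp add: B_def algebra_simps)
        finally have "real (N m) ^ 2 * real q ^ 5 \<le> (B * real q ^ (c + 3)) ^ 2 * real q ^ 5"
          by (intro mult_right_mono power_mono) auto
        also have "\<dots> = B ^ 2 * real q ^ k"
          by (simp add: k_def power_mult_distrib power_add power_mult mult_ac flip: power_mult)
        also have "\<dots> = B ^ 2 * real D ^ k * real m ^ k" by (simp add: q_def power_mult_distrib)
        finally show ?thesis unfolding q_def by (intro divide_right_mono) auto
      qed
    qed
  qed simp
  have F_lim: "F \<longlonglongrightarrow> 0"
  proof -
    have "(\<lambda>m. (4 + C1 + 1) / 4 ^ m) \<longlonglongrightarrow> 0" by real_asymp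
    from tendsto_add[OF this tendsto_mult_left[OF decay, of 96]]
    have "(\<lambda>m. (4 + C1 + 1) / 4 ^ m + 96 * (real (N m) ^ 2 * real (D * m) ^ 5 / 2 ^ m)) \<longlonglongrightarrow> 0"
      by (simp only: mult_zero_right add_0)
    moreover have "F = (\<lambda>m. (4 + C1 + 1) / 4 ^ m + 96 * (real (N m) ^ 2 * real (D * m) ^ 5 / 2 ^ m))"
      by (rule ext) (rule F_def)
    ultimately show ?thesis by simp
  qed
  \<comment> \<open>This m is the integer part of the base 4 logarithm of n.\<close>
  have "\<exists>m. 4 ^ m \<le> n \<and> n < 4 * 4 ^ m" if "1 \<le> n" for n :: nat
    using ex_power_ivl1[of 4 n] that by simp
  then obtain m where m: "\<And>n::nat. 1 \<le> n \<Longrightarrow> 4 ^ m n \<le> n \<and> n < 4 * 4 ^ m n" by metis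
  have m_lim: "filterlim m sequentially sequentially"
    unfolding filterlim_at_top
  proof
    fix Z
    show "\<forall>\<^sub>F n in sequentially. Z \<le> m n"
      unfolding eventually_sequentially
    proof (intro exI allI impI)
      fix n :: nat assume n: "4 ^ Suc Z \<le> n"
      have "(1::nat) \<le> 4 ^ Suc Z" by simp
      then have "1 \<le> n" using n by linarith
      then have "n < 4 ^ Suc (m n)" using m[of n] by simp
      then have "(4::nat) ^ Suc Z < 4 ^ Suc (m n)" using n by linarith
      then show "Z \<le> m n" by simp
    qed
  qed
  show thesis
  proof (rule that)
    show "0 \<le> poly (g ^ m n) t" if "0 \<le> t" "t \<le> K" for n t
      using g(2)[OF that] by simp
    show "1 \<le> poly (g ^ m n) t" if "r' \<le> t" "t \<le> K" for n t
      using g(3)[OF that] by (simp add: one_le_power)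
    have ev: "\<forall>\<^sub>F m in sequentially. 1 \<le> m \<and> real (N m) ^ 2 * real (D * m) ^ 5 / 2 ^ m \<le> 1 / 2"
    proof -
      have "\<forall>\<^sub>F m in sequentially. real (N m) ^ 2 * real (D * m) ^ 5 / 2 ^ m < 1 / 2"
        by (rule order_tendstoD(2)[OF decay]) simp
      with eventually_ge_at_top[of "1::nat"] show ?thesis by eventually_elim auto
    qed
    have "\<forall>\<^sub>F n in sequentially. real n * cmod (moment (a n) (g ^ m n)) \<le> F (m n)"
      using eventually_compose_filterlim[OF ev m_lim] eventually_ge_at_top[of "1::nat"]
      by eventually_elim (use m estimate in blast)
    then show "(\<lambda>n. real n * cmod (moment (a n) (g ^ m n))) \<longlonglongrightarrow> 0"
      by (intro tendsto_sandwich[OF _ _ tendsto_const filterlim_compose[OF F_lim m_lim]]) auto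
  qed
qed

section \<open>The group algebra and its regular representation\<close>

lemma ga_linear_ext_superset:
  assumes "finite T" and "Poly_Mapping.keys x \<subseteq> T"
  shows "ga_linear_ext f x = (\<Sum>g\<in>T. Poly_Mapping.lookup x g * f g)"
  unfolding ga_linear_ext_def
  by (rule sum.mono_neutral_left) (use assms in \<open>auto simp: in_keys_iff\<close>)

lemma ga_linear_ext_0 [simp]: "ga_linear_ext f 0 = 0"
  by (simp add: ga_linear_ext_def)

lemma ga_linear_ext_add: "ga_linear_ext f (x + y) = ga_linear_ext f x + ga_linear_ext f y"
proof -
  let ?T = "Poly_Mapping.keys x \<union> Poly_Mapping.keys y"
  have "Poly_Mapping.keys (x + y) \<subseteq> ?T" by (rule keys_add)
  then show ?thesis
    by (simp add: ga_linear_ext_superset[of ?T] lookup_add algebra_simps sum.distrib)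
qed

lemma ga_linear_ext_sum: "ga_linear_ext f (\<Sum>i\<in>I. z i) = (\<Sum>i\<in>I. ga_linear_ext f (z i))"
  by (induction I rule: infinite_finite_induct) (auto simp: ga_linear_ext_add)

lemma ga_linear_ext_single [simp]: "ga_linear_ext f (Poly_Mapping.single g c) = c * f g"
  by (simp add: ga_linear_ext_superset[of "{g}"])

lemma poly_mapping_eq_sum_single:
  "x = (\<Sum>g\<in>Poly_Mapping.keys x. Poly_Mapping.single g (Poly_Mapping.lookup x g))"
proof (rule poly_mapping_eqI)
  fix k
  have "(\<Sum>g\<in>Poly_Mapping.keys x. Poly_Mapping.lookup x g when g = k) = Poly_Mapping.lookup x k"
    by (simp add: "when_def" in_keys_iff)
  then show "Poly_Mapping.lookup x k
      = Poly_Mapping.lookup (\<Sum>g\<in>Poly_Mapping.keys x. Poly_Mapping.single g (Poly_Mapping.lookup x g)) k"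
    by (simp add: lookup_sum lookup_single)
qed

text \<open>Only the left factor is expanded, and the right one meets a translate of f. This shape
  supports inductions over powers in which f varies.\<close>

lemma ga_linear_ext_mult:
  fixes x y :: "'g::group_add group_algebra"
  shows "ga_linear_ext f (x * y)
    = (\<Sum>g\<in>Poly_Mapping.keys x. Poly_Mapping.lookup x g * ga_linear_ext (\<lambda>h. f (g + h)) y)"
proof -
  have "x * y = (\<Sum>g\<in>Poly_Mapping.keys x. \<Sum>h\<in>Poly_Mapping.keys y.
      Poly_Mapping.single g (Poly_Mapping.lookup x g) * Poly_Mapping.single h (Poly_Mapping.lookup y h))"
    unfolding sum_product[symmetric] poly_mapping_eq_sum_single[symmetric] ..
  then show ?thesis
    by (simp add: ga_linear_ext_sum mult_single ga_linear_ext_def[of _ y] sum_distrib_left mult.assoc)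
qed

lemma ga_linear_ext_1: "ga_linear_ext f (1 :: 'g::group_add group_algebra) = f 0"
  using ga_linear_ext_single[of f 0 1] by simp

lemma lookup_ga_star:
  fixes x :: "'g::group_add group_algebra"
  shows "Poly_Mapping.lookup (ga_star x) g = cnj (Poly_Mapping.lookup x (- g))"
proof -
  have "inj (uminus :: 'g \<Rightarrow> 'g)" by (simp add: inj_def)
  then show ?thesis
    unfolding ga_star_def by (simp add: Poly_Mapping.map.rep_eq map_key.rep_eq "when_def")
qed

lemma keys_ga_star:
  fixes x :: "'g::group_add group_algebra"
  shows "Poly_Mapping.keys (ga_star x) = uminus ` Poly_Mapping.keys x"
proof -
  have "g \<in> Poly_Mapping.keys (ga_star x) \<longleftrightarrow> - g \<in> Poly_Mapping.keys x" for g
    by (simp add: in_keys_iff lookup_ga_star)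
  then show ?thesis by (force simp: image_iff)
qed

lemma ga_linear_ext_star:
  fixes x :: "'g::group_add group_algebra"
  shows "ga_linear_ext f (ga_star x)
    = (\<Sum>g\<in>Poly_Mapping.keys x. cnj (Poly_Mapping.lookup x g) * f (- g))"
  unfolding ga_linear_ext_def keys_ga_star
  by (subst sum.reindex) (auto simp: lookup_ga_star)

lemma lookup_eq_ga_linear_ext: "Poly_Mapping.lookup x g = ga_linear_ext (\<lambda>h. if h = g then 1 else 0) x"
  by (simp add: ga_linear_ext_def in_keys_iff if_distrib cong: if_cong)

text \<open>The coefficient at k sums conj(x_g) x_h over - g + h = k; conjugation together with k to
  - k exchanges the roles of g and h.\<close>

lemma ga_selfadjoint_star_mult:
  fixes x :: "'g::group_add group_algebra"
  shows "ga_selfadjoint (ga_star x * x)"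
  unfolding ga_selfadjoint_def
proof (rule poly_mapping_eqI)
  fix k :: 'g
  have l: "Poly_Mapping.lookup (ga_star x * x) k = (\<Sum>g\<in>Poly_Mapping.keys x. \<Sum>h\<in>Poly_Mapping.keys x.
      cnj (Poly_Mapping.lookup x g) * Poly_Mapping.lookup x h * (if - g + h = k then 1 else 0))" for k
    by (subst lookup_eq_ga_linear_ext)
      (simp add: ga_linear_ext_mult keys_ga_star sum.reindex lookup_ga_star
        ga_linear_ext_def[of _ x] sum_distrib_left mult.assoc)
  have e: "(- g + h = - k) = (- h + g = k)" for g h :: 'g
    by (metis add.inverse_inverse minus_add)
  have "cnj (Poly_Mapping.lookup (ga_star x * x) (- k)) = (\<Sum>g\<in>Poly_Mapping.keys x. \<Sum>h\<in>Poly_Mapping.keys x.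
      cnj (Poly_Mapping.lookup x h) * Poly_Mapping.lookup x g * (if - h + g = k then 1 else 0))"
    unfolding l cnj_sum complex_cnj_mult e by (intro sum.cong refl) auto
  also have "\<dots> = Poly_Mapping.lookup (ga_star x * x) k"
    unfolding l by (rule sum.swap)
  finally show "Poly_Mapping.lookup (ga_star (ga_star x * x)) k = Poly_Mapping.lookup (ga_star x * x) k"
    by (simp add: lookup_ga_star)
qed

text \<open>This norm bounds the image under every unitary representation, uniformly in the
  dimension, and so supplies a deterministic interval for all spectra.\<close>

definition ga_l1_norm :: "'g group_algebra \<Rightarrow> real" where
  "ga_l1_norm x = (\<Sum>g\<in>Poly_Mapping.keys x. cmod (Poly_Mapping.lookup x g))"

lemma ga_l1_norm_nonneg: "0 \<le> ga_l1_norm x"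
  by (simp add: ga_l1_norm_def sum_nonneg)

section \<open>Word length and powers in the group algebra\<close>

lemma word_length_witness:
  assumes "generates S"
  obtains w where "w \<in> words S" "length w = word_length S g" "sum_list w = g"
proof -
  obtain w where "w \<in> words S" "sum_list w = g" using assms by (auto simp: generates_def)
  then have "\<exists>k. \<exists>w\<in>words S. length w = k \<and> sum_list w = g" by blast
  from LeastI_ex[OF this] show thesis using that by (auto simp: word_length_def)
qed

lemma word_length_le: "w \<in> words S \<Longrightarrow> word_length S (sum_list w) \<le> length w"
  unfolding word_length_def by (rule Least_le) auto

lemma word_length_add:
  assumes "generates S"
  shows "word_length S (g + h) \<le> word_length S g + word_length S h"
proof -
  obtain v where v: "v \<in> words S" "length v = word_length S g" "sum_list v = g"
    by (rule word_length_witness[OF assms])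
  obtain w where w: "w \<in> words S" "length w = word_length S h" "sum_list w = h"
    by (rule word_length_witness[OF assms])
  have "v @ w \<in> words S" using v(1) w(1) by (simp add: words_def)
  from word_length_le[OF this] show ?thesis using v w by simp
qed

lemma word_length_0: "word_length S 0 = 0"
  using word_length_le[of "[]" S] by (simp add: words_def)

text \<open>The support of y^p lies in the ball of radius p R, and its l1 norm is at most the p-th
  power of that of y. This transfers an estimate known for single group elements of bounded length,
  such as (A1), to y^p.\<close>

lemma norm_ga_linear_ext_power_le:
  fixes y :: "'g::group_add group_algebra"
  assumes "generates S" and R: "\<And>g. g \<in> Poly_Mapping.keys y \<Longrightarrow> word_length S g \<le> R"
    and "0 \<le> b" and "\<And>g. word_length S g \<le> p * R \<Longrightarrow> cmod (f g) \<le> b"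
  shows "cmod (ga_linear_ext f (y ^ p)) \<le> ga_l1_norm y ^ p * b"
  using assms(4)
proof (induction p arbitrary: f)
  case 0
  then show ?case by (simp add: ga_linear_ext_1 word_length_0)
next
  case (Suc p)
  have "cmod (ga_linear_ext f (y ^ Suc p))
      \<le> (\<Sum>g\<in>Poly_Mapping.keys y. cmod (Poly_Mapping.lookup y g) * cmod (ga_linear_ext (\<lambda>h. f (g + h)) (y ^ p)))"
    by (auto simp: ga_linear_ext_mult norm_mult intro!: order_trans[OF norm_sum])
  also have "\<dots> \<le> (\<Sum>g\<in>Poly_Mapping.keys y. cmod (Poly_Mapping.lookup y g) * (ga_l1_norm y ^ p * b))"
  proof (intro sum_mono mult_left_mono Suc.IH Suc.prems)
    fix g h assume "g \<in> Poly_Mapping.keys y" "word_length S h \<le> p * R"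
    then show "word_length S (g + h) \<le> Suc p * R"
      using word_length_add[OF assms(1), of g h] R[of g] by simp
  qed auto
  also have "\<dots> = ga_l1_norm y ^ Suc p * b"
    by (simp add: ga_l1_norm_def[of y] sum_distrib_right[symmetric])
  finally show ?case .
qed

section \<open>Square summable functions and convolution operators\<close>

lemma ell2_L2_set_le:
  assumes "f \<in> ell2" and "finite F"
  shows "L2_set (\<lambda>h. cmod (f h)) F \<le> ell2_norm f"
  unfolding L2_set_def ell2_norm_def using assms
  by (intro real_sqrt_le_mono finite_sum_le_infsum) (auto simp: ell2_def)

text \<open>Together with the preceding bound this reduces statements about infinite sums to uniform
  estimates on finite sets, where the finite Minkowski and Cauchy-Schwarz inequalities
  apply.\<close>

lemma ell2_I:
  assumes "0 \<le> c" and "\<And>F. finite F \<Longrightarrow> L2_set (\<lambda>h. cmod (f h)) F \<le> c"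
  shows "f \<in> ell2" and "ell2_norm f \<le> c"
proof -
  have fin: "(\<Sum>h\<in>F. (cmod (f h))\<^sup>2) \<le> c\<^sup>2" if "finite F" for F
    using assms(2)[OF that] assms(1) unfolding L2_set_def by (simp add: real_le_lsqrt sqrt_le_D sum_nonneg)
  have sm: "(\<lambda>h. (cmod (f h))\<^sup>2) summable_on UNIV"
    by (rule nonneg_bounded_partial_sums_imp_summable_on[where C = "c\<^sup>2"])
      (auto simp: fin intro!: eventually_finite_subsets_at_top_weakI)
  then show "f \<in> ell2" by (simp add: ell2_def)
  have "(\<Sum>\<^sub>\<infinity>h. (cmod (f h))\<^sup>2) \<le> c\<^sup>2"
    by (rule infsum_le_finite_sums[OF sm]) (use fin in auto)
  then show "ell2_norm f \<le> c"
    unfolding ell2_norm_def using assms(1) by (simp add: real_le_lsqrt infsum_nonneg)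
qed

lemma ell2_norm_nonneg: "0 \<le> ell2_norm f"
  by (simp add: ell2_norm_def infsum_nonneg)

lemma norm_le_ell2_norm: "f \<in> ell2 \<Longrightarrow> cmod (f g) \<le> ell2_norm f"
  using ell2_L2_set_le[of f "{g}"] by (simp add: L2_set_def)

lemma left_regular_ext_eq: "left_regular_ext x f h = ga_linear_ext (\<lambda>g. f (- g + h)) x"
  by (simp add: left_regular_ext_def ga_linear_ext_def left_regular_def)

lemma left_regular_ext_mult:
  "left_regular_ext (x * y) f = left_regular_ext x (left_regular_ext y f)"
  by (rule ext) (simp add: left_regular_ext_eq ga_linear_ext_mult minus_add,
      simp add: ga_linear_ext_def add.assoc[symmetric])

lemma L2_set_sum_le:
  "L2_set (\<lambda>h. cmod (\<Sum>g\<in>K. w g h)) F \<le> (\<Sum>g\<in>K. L2_set (\<lambda>h. cmod (w g h)) F)"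
proof (induction K rule: infinite_finite_induct)
  case (insert g K)
  have "L2_set (\<lambda>h. cmod (\<Sum>g\<in>insert g K. w g h)) F
      \<le> L2_set (\<lambda>h. cmod (w g h) + cmod (\<Sum>g\<in>K. w g h)) F"
    using insert by (intro L2_set_mono) (auto simp: norm_triangle_ineq)
  also have "\<dots> \<le> L2_set (\<lambda>h. cmod (w g h)) F + L2_set (\<lambda>h. cmod (\<Sum>g\<in>K. w g h)) F"
    by (rule L2_set_triangle_ineq)
  finally show ?case using insert by simp
qed (auto simp: L2_set_def)

text \<open>A left translation maps a finite set injectively to a finite set, so each translate of f
  has partial norms below \<open>ell2_norm f\<close>. The bound also makes the supremum in
  \<open>ell2_opnorm\<close> one over a bounded set.\<close>

lemma left_regular_ext_bounded:
  assumes f: "f \<in> ell2"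
  shows "left_regular_ext x f \<in> ell2"
    and "ell2_norm (left_regular_ext x f) \<le> ga_l1_norm x * ell2_norm f"
proof -
  have "L2_set (\<lambda>h. cmod (left_regular_ext x f h)) F \<le> ga_l1_norm x * ell2_norm f" if F: "finite F" for F
  proof -
    have shift: "L2_set (\<lambda>h. cmod (f (- g + h))) F \<le> ell2_norm f" for g
    proof -
      have "L2_set (\<lambda>h. cmod (f (- g + h))) F = L2_set (\<lambda>h. cmod (f h)) ((\<lambda>h. - g + h) ` F)"
        unfolding L2_set_def by (subst sum.reindex) (auto simp: inj_on_def)
      also have "\<dots> \<le> ell2_norm f" by (rule ell2_L2_set_le[OF f]) (use F in simp)
      finally show ?thesis .
    qed
    have "L2_set (\<lambda>h. cmod (left_regular_ext x f h)) F
        \<le> (\<Sum>g\<in>Poly_Mapping.keys x. L2_set (\<lambda>h. cmod (Poly_Mapping.lookup x g * f (- g + h))) F)"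
      unfolding left_regular_ext_eq ga_linear_ext_def by (rule L2_set_sum_le)
    also have "\<dots> = (\<Sum>g\<in>Poly_Mapping.keys x. cmod (Poly_Mapping.lookup x g) * L2_set (\<lambda>h. cmod (f (- g + h))) F)"
      by (simp add: norm_mult L2_set_right_distrib)
    also have "\<dots> \<le> (\<Sum>g\<in>Poly_Mapping.keys x. cmod (Poly_Mapping.lookup x g) * ell2_norm f)"
      by (intro sum_mono mult_left_mono shift) auto
    finally show ?thesis by (simp add: ga_l1_norm_def sum_distrib_right)
  qed
  moreover have "0 \<le> ga_l1_norm x * ell2_norm f"
    by (simp add: ga_l1_norm_nonneg ell2_norm_nonneg)
  ultimately show "left_regular_ext x f \<in> ell2"
    and "ell2_norm (left_regular_ext x f) \<le> ga_l1_norm x * ell2_norm f"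
    using ell2_I[of "ga_l1_norm x * ell2_norm f" "left_regular_ext x f"] by blast+
qed

lemma ell2_scale:
  assumes "f \<in> ell2"
  shows "(\<lambda>h. c * f h) \<in> ell2" and "ell2_norm (\<lambda>h. c * f h) = cmod c * ell2_norm f"
  using assms summable_on_cmult_right[of "\<lambda>h. (cmod (f h))\<^sup>2" UNIV "(cmod c)\<^sup>2"]
  by (auto simp: ell2_def ell2_norm_def norm_mult power_mult_distrib infsum_cmult_right real_sqrt_mult)

lemma ell2_norm_left_regular_ext_le:
  fixes x :: "'g::group_add group_algebra"
  assumes f: "f \<in> ell2"
  shows "ell2_norm (left_regular_ext x f) \<le> ell2_opnorm (left_regular_ext x) * ell2_norm f"
proof (cases "ell2_norm f = 0")
  case True
  then show ?thesis using left_regular_ext_bounded(2)[OF f, of x] by simp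
next
  case False
  then have pos: "0 < ell2_norm f" using ell2_norm_nonneg[of f] by simp
  define c where "c = complex_of_real (1 / ell2_norm f)"
  have c: "cmod c = 1 / ell2_norm f" unfolding c_def norm_of_real using pos by simp
  let ?B = "{f :: 'g \<Rightarrow> complex. f \<in> ell2 \<and> ell2_norm f \<le> 1}"
  have "bdd_above ((\<lambda>f. ell2_norm (left_regular_ext x f)) ` ?B)"
  proof (rule bdd_aboveI2)
    fix f assume "f \<in> ?B"
    then have "ell2_norm (left_regular_ext x f) \<le> ga_l1_norm x * ell2_norm f" "ell2_norm f \<le> 1"
      using left_regular_ext_bounded(2) by auto
    moreover have "ga_l1_norm x * ell2_norm f \<le> ga_l1_norm x * 1"
      using \<open>ell2_norm f \<le> 1\<close> by (intro mult_left_mono ga_l1_norm_nonneg)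
    ultimately show "ell2_norm (left_regular_ext x f) \<le> ga_l1_norm x" by simp
  qed
  moreover have "(\<lambda>h. c * f h) \<in> ?B" using ell2_scale[OF f, of c] c pos by simp
  ultimately have "ell2_norm (left_regular_ext x (\<lambda>h. c * f h)) \<le> ell2_opnorm (left_regular_ext x)"
    unfolding ell2_opnorm_def by (rule cSUP_upper[rotated])
  moreover have "left_regular_ext x (\<lambda>h. c * f h) = (\<lambda>h. c * left_regular_ext x f h)"
    by (rule ext) (simp add: left_regular_ext_eq ga_linear_ext_def sum_distrib_left mult_ac)
  ultimately have "1 / ell2_norm f * ell2_norm (left_regular_ext x f) \<le> ell2_opnorm (left_regular_ext x)"
    using ell2_scale(2)[OF left_regular_ext_bounded(1)[OF f], of c x] c by simp
  then show ?thesis using pos by (simp add: field_simps)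
qed

lemma delta_in_ell2: "delta g \<in> ell2" and ell2_norm_delta: "ell2_norm (delta g) = 1"
proof -
  have le: "L2_set (\<lambda>h. cmod (delta g h)) F \<le> 1" if "finite F" for F
  proof -
    have "(\<Sum>h\<in>F. (cmod (delta g h))\<^sup>2) = (\<Sum>h\<in>F. if h = g then 1 else 0)"
      by (intro sum.cong) (auto simp: delta_def)
    then show ?thesis unfolding L2_set_def using that by simp
  qed
  show d: "delta g \<in> ell2" using ell2_I(1)[OF _ le] by simp
  show "ell2_norm (delta g) = 1"
    using ell2_I(2)[OF _ le] norm_le_ell2_norm[OF d, of g] by (simp add: delta_def)
qed

lemma ell2_opnorm_left_regular_ext_nonneg:
  fixes x :: "'g::group_add group_algebra"
  shows "0 \<le> ell2_opnorm (left_regular_ext x)"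
  using ell2_norm_left_regular_ext_le[OF delta_in_ell2[of "0::'g"], of x]
    ell2_norm_nonneg[of "left_regular_ext x (delta 0)"]
  by (simp add: ell2_norm_delta)

lemma ell2_opnorm_le:
  assumes "\<And>f. f \<in> ell2 \<Longrightarrow> ell2_norm f \<le> 1 \<Longrightarrow> ell2_norm (a f) \<le> c"
  shows "ell2_opnorm a \<le> c"
proof -
  have "(\<lambda>h. 0) \<in> {f \<in> ell2. ell2_norm f \<le> 1}" by (simp add: ell2_def ell2_norm_def)
  then show ?thesis unfolding ell2_opnorm_def using assms by (intro cSUP_least) auto
qed

text \<open>Testing \<open>\<lambda>(x\<^sup>*) f\<close> against its own finite truncations keeps all sums finite, so no inner
  product on \<open>\<ell>\<^sup>2\<close> is needed.\<close>
lemma ell2_norm_left_regular_ext_star_le: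
  fixes x :: "'g::group_add group_algebra"
  assumes f: "f \<in> ell2"
  shows "ell2_norm (left_regular_ext (ga_star x) f) \<le> ell2_opnorm (left_regular_ext x) * ell2_norm f"
proof (rule ell2_I(2))
  let ?c = "ell2_opnorm (left_regular_ext x)"
  show "0 \<le> ?c * ell2_norm f"
    by (simp add: ell2_opnorm_left_regular_ext_nonneg ell2_norm_nonneg)
  fix F :: "'g set" assume F: "finite F"
  define w where "w = left_regular_ext (ga_star x) f"
  define wF where "wF = (\<lambda>h. if h \<in> F then w h else 0)"
  \<comment> \<open>One finite set containing g + F for all g in the support lets the sums over the
    different translates of F be interchanged.\<close>
  define T where "T = (\<lambda>(g, h). g + h) ` (Poly_Mapping.keys x \<times> F)"
  let ?n = "L2_set (\<lambda>h. cmod (w h)) F"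
  have T: "finite T" using F by (simp add: T_def)
  have wF_le: "L2_set (\<lambda>h. cmod (wF h)) G \<le> ?n" if "finite G" for G
  proof -
    have "(\<Sum>h\<in>G. (cmod (wF h))\<^sup>2) = (\<Sum>h\<in>G \<inter> F. (cmod (w h))\<^sup>2)"
      using that by (intro sum.mono_neutral_cong_right) (auto simp: wF_def)
    also have "\<dots> \<le> (\<Sum>h\<in>F. (cmod (w h))\<^sup>2)" using F by (intro sum_mono2) auto
    finally show ?thesis by (simp add: L2_set_def)
  qed
  have wF: "wF \<in> ell2" "ell2_norm wF \<le> ?n"
    using ell2_I[of ?n wF] wF_le by auto
  have "complex_of_real (?n\<^sup>2) = (\<Sum>h\<in>F. cnj (w h) * w h)"
  proof -
    have "complex_of_real (?n\<^sup>2) = (\<Sum>h\<in>F. complex_of_real ((cmod (w h))\<^sup>2))"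
      by (simp add: L2_set_def sum_nonneg)
    also have "\<dots> = (\<Sum>h\<in>F. cnj (w h) * w h)"
      by (simp only: complex_norm_square mult.commute[of "cnj _"])
    finally show ?thesis .
  qed
  also have "\<dots> = (\<Sum>h\<in>F. \<Sum>g\<in>Poly_Mapping.keys x. cnj (wF h) * cnj (Poly_Mapping.lookup x g) * f (g + h))"
    by (intro sum.cong) (auto simp: w_def wF_def left_regular_ext_eq ga_linear_ext_star sum_distrib_left mult.assoc)
  also have "\<dots> = (\<Sum>g\<in>Poly_Mapping.keys x. \<Sum>h\<in>F. cnj (wF h) * cnj (Poly_Mapping.lookup x g) * f (g + h))"
    by (rule sum.swap)
  also have "\<dots> = (\<Sum>g\<in>Poly_Mapping.keys x. \<Sum>k\<in>T. cnj (wF (- g + k)) * cnj (Poly_Mapping.lookup x g) * f k)"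
  proof (rule sum.cong[OF refl])
    fix g assume g: "g \<in> Poly_Mapping.keys x"
    have "(\<Sum>h\<in>F. cnj (wF h) * cnj (Poly_Mapping.lookup x g) * f (g + h))
        = (\<Sum>k\<in>(\<lambda>h. g + h) ` F. cnj (wF (- g + k)) * cnj (Poly_Mapping.lookup x g) * f k)"
      by (subst sum.reindex) (auto simp: inj_on_def add.assoc[symmetric])
    also have "\<dots> = (\<Sum>k\<in>T. cnj (wF (- g + k)) * cnj (Poly_Mapping.lookup x g) * f k)"
    proof (rule sum.mono_neutral_left[OF T])
      show "(\<lambda>h. g + h) ` F \<subseteq> T" using g by (auto simp: T_def)
      show "\<forall>k\<in>T - (\<lambda>h. g + h) ` F. cnj (wF (- g + k)) * cnj (Poly_Mapping.lookup x g) * f k = 0"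
      proof
        fix k assume k: "k \<in> T - (\<lambda>h. g + h) ` F"
        have "k = g + (- g + k)" by (simp add: add.assoc[symmetric])
        then have "- g + k \<notin> F" using k by blast
        then show "cnj (wF (- g + k)) * cnj (Poly_Mapping.lookup x g) * f k = 0" by (simp add: wF_def)
      qed
    qed
    finally show "(\<Sum>h\<in>F. cnj (wF h) * cnj (Poly_Mapping.lookup x g) * f (g + h))
        = (\<Sum>k\<in>T. cnj (wF (- g + k)) * cnj (Poly_Mapping.lookup x g) * f k)" .
  qed
  also have "\<dots> = (\<Sum>k\<in>T. cnj (left_regular_ext x wF k) * f k)"
    by (subst sum.swap) (simp add: left_regular_ext_eq ga_linear_ext_def sum_distrib_left mult_ac)
  finally have "?n\<^sup>2 = cmod (\<Sum>k\<in>T. cnj (left_regular_ext x wF k) * f k)"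
    by (metis norm_of_real abs_of_nonneg zero_le_power2)
  also have "\<dots> \<le> (\<Sum>k\<in>T. \<bar>cmod (left_regular_ext x wF k)\<bar> * \<bar>cmod (f k)\<bar>)"
    by (rule order_trans[OF norm_sum]) (simp add: norm_mult)
  also have "\<dots> \<le> L2_set (\<lambda>k. cmod (left_regular_ext x wF k)) T * L2_set (\<lambda>k. cmod (f k)) T"
    by (rule L2_set_mult_ineq)
  also have "\<dots> \<le> ell2_norm (left_regular_ext x wF) * ell2_norm f"
    by (intro mult_mono ell2_L2_set_le left_regular_ext_bounded wF f T) (auto simp: ell2_norm_nonneg)
  also have "\<dots> \<le> (?c * ?n) * ell2_norm f"
  proof (rule mult_right_mono[OF _ ell2_norm_nonneg])
    have "ell2_norm (left_regular_ext x wF) \<le> ?c * ell2_norm wF"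
      by (rule ell2_norm_left_regular_ext_le[OF wF(1)])
    also have "\<dots> \<le> ?c * ?n" by (intro mult_left_mono wF(2) ell2_opnorm_left_regular_ext_nonneg)
    finally show "ell2_norm (left_regular_ext x wF) \<le> ?c * ?n" .
  qed
  finally have "?n * ?n \<le> ?n * (?c * ell2_norm f)"
    by (simp add: power2_eq_square mult_ac)
  moreover have "0 \<le> ?n" by simp
  ultimately have "?n \<le> ?c * ell2_norm f"
    using \<open>0 \<le> ?c * ell2_norm f\<close> mult_le_cancel_left_pos[of ?n ?n "?c * ell2_norm f"]
    by (cases "?n = 0") auto
  then show "L2_set (\<lambda>h. cmod (left_regular_ext (ga_star x) f h)) F \<le> ?c * ell2_norm f"
    by (simp add: w_def)
qed

text \<open>The adjoint bound is applied to \<lambda>(x) f. Hence any rate above the square of the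
  norm of \<lambda>(x) dominates the growth of the first two orders of the moments of
  \<open>ga_star x * x\<close>.\<close>

lemma ell2_opnorm_star_mult_le:
  fixes x :: "'g::group_add group_algebra"
  shows "ell2_opnorm (left_regular_ext (ga_star x * x)) \<le> (ell2_opnorm (left_regular_ext x))\<^sup>2"
proof (rule ell2_opnorm_le)
  let ?c = "ell2_opnorm (left_regular_ext x)"
  fix f :: "'g \<Rightarrow> complex" assume f: "f \<in> ell2" "ell2_norm f \<le> 1"
  have "ell2_norm (left_regular_ext (ga_star x * x) f) \<le> ?c * ell2_norm (left_regular_ext x f)"
    unfolding left_regular_ext_mult
    by (rule ell2_norm_left_regular_ext_star_le[OF left_regular_ext_bounded(1)[OF f(1)]])
  also have "\<dots> \<le> ?c * (?c * ell2_norm f)"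
    by (intro mult_left_mono ell2_norm_left_regular_ext_le ell2_opnorm_left_regular_ext_nonneg f)
  also have "\<dots> \<le> ?c * (?c * 1)"
    by (intro mult_left_mono f ell2_opnorm_left_regular_ext_nonneg)
  finally show "ell2_norm (left_regular_ext (ga_star x * x) f) \<le> ?c\<^sup>2"
    by (simp add: power2_eq_square)
qed

lemma canonical_trace_left_regular: "canonical_trace (left_regular g) = (if g = 0 then 1 else 0)"
proof -
  have "canonical_trace (left_regular g) = (\<Sum>\<^sub>\<infinity>h\<in>{0}. left_regular g (delta 0) h)"
    unfolding canonical_trace_def ell2_inner_def
    by (intro infsum_cong_neutral) (auto simp: delta_def)
  then show ?thesis by (auto simp: left_regular_def delta_def)
qed

text \<open>The coefficient of y^p at the identity is the value at 0 of \<lambda>(y)^p applied to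
  \<open>delta 0\<close>, and a coordinate is at most the norm.\<close>

lemma ga_linear_ext_delta_power_le:
  fixes y :: "'g::group_add group_algebra"
  shows "cmod (ga_linear_ext (\<lambda>g. if g = 0 then 1 else 0) (y ^ p)) \<le> ell2_opnorm (left_regular_ext y) ^ p"
proof -
  have "left_regular_ext (y ^ p) (delta 0) \<in> ell2
      \<and> ell2_norm (left_regular_ext (y ^ p) (delta 0)) \<le> ell2_opnorm (left_regular_ext y) ^ p"
  proof (induction p)
    case 0
    have "left_regular_ext 1 (delta 0) = delta (0::'g)"
      by (rule ext) (simp add: left_regular_ext_eq ga_linear_ext_1)
    then show ?case by (simp add: delta_in_ell2 ell2_norm_delta)
  next
    case (Suc p)
    then show ?case
      by (auto simp: left_regular_ext_mult intro!: left_regular_ext_bounded(1)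
        order_trans[OF ell2_norm_left_regular_ext_le] mult_left_mono ell2_opnorm_left_regular_ext_nonneg)
  qed
  then have "cmod (left_regular_ext (y ^ p) (delta 0) 0) \<le> ell2_opnorm (left_regular_ext y) ^ p"
    by (auto intro: order_trans[OF norm_le_ell2_norm])
  moreover have "left_regular_ext (y ^ p) (delta 0) 0 = ga_linear_ext (\<lambda>g. if g = 0 then 1 else 0) (y ^ p)"
    unfolding left_regular_ext_eq by (simp add: delta_def)
  ultimately show ?thesis by simp
qed

section \<open>Complex matrices\<close>

lemma index_mat_adjoint:
  assumes "i < dim_col A" "j < dim_row A"
  shows "mat_adjoint A $$ (i, j) = cnj (A $$ (j, i))"
  using assms by (simp add: mat_adjoint_def mat_of_rows_index)

lemma mat_adjoint_dim [simp]: "dim_row (mat_adjoint A) = dim_col A" "dim_col (mat_adjoint A) = dim_row A"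
  by (simp_all add: mat_adjoint_def)

lemma mat_adjoint_carrier [simp]: "A \<in> carrier_mat n m \<Longrightarrow> mat_adjoint A \<in> carrier_mat m n"
  using carrier_matI[of "mat_adjoint A"] mat_adjoint_dim[of A] by (simp only: carrier_matD)

lemma index_mult_mat_sum:
  assumes "A \<in> carrier_mat n m" "B \<in> carrier_mat m k" "i < n" "j < k"
  shows "(A * B) $$ (i, j) = (\<Sum>l<m. A $$ (i, l) * B $$ (l, j))"
  using assms by (simp add: scalar_prod_def atLeast0LessThan)

lemma index_mult_mat_vec_sum:
  assumes "A \<in> carrier_mat n m" "v \<in> carrier_vec m" "i < n"
  shows "vec_index (A *\<^sub>v v) i = (\<Sum>l<m. A $$ (i, l) * vec_index v l)"
  using assms by (simp add: scalar_prod_def atLeast0LessThan)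

definition mat_Tr :: "'a::comm_monoid_add mat \<Rightarrow> 'a" where
  "mat_Tr A = (\<Sum>i<dim_row A. A $$ (i, i))"

lemma mat_Tr_mult_commute:
  fixes A B :: "'a::comm_semiring_0 mat"
  assumes "A \<in> carrier_mat n m" "B \<in> carrier_mat m n"
  shows "mat_Tr (A * B) = mat_Tr (B * A)"
proof -
  have "mat_Tr (A * B) = (\<Sum>i<n. \<Sum>l<m. A $$ (i, l) * B $$ (l, i))"
    using assms by (simp add: mat_Tr_def scalar_prod_def atLeast0LessThan)
  also have "\<dots> = (\<Sum>l<m. \<Sum>i<n. B $$ (l, i) * A $$ (i, l))"
    by (subst sum.swap) (simp add: mult.commute)
  also have "\<dots> = mat_Tr (B * A)"
    using assms by (simp add: mat_Tr_def scalar_prod_def atLeast0LessThan)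
  finally show ?thesis .
qed

lemma upper_triangular_mult:
  fixes A B :: "'a::semiring_0 mat"
  assumes A: "A \<in> carrier_mat n n" "upper_triangular A" and B: "B \<in> carrier_mat n n" "upper_triangular B"
  shows "upper_triangular (A * B)"
    and "i < n \<Longrightarrow> (A * B) $$ (i, i) = A $$ (i, i) * B $$ (i, i)"
proof -
  have zero: "A $$ (i, l) * B $$ (l, j) = 0" if "i < n" "l < n" "l < i \<or> j < l" for i j l
    using that A B by (auto simp: upper_triangular_def)
  show "upper_triangular (A * B)"
  proof (rule upper_triangularI)
    fix i j assume "j < i" "i < dim_row (A * B)"
    then show "(A * B) $$ (i, j) = 0"
      using A B by (subst index_mult_mat_sum[OF A(1) B(1)]) (auto intro!: sum.neutral zero)
  qed
  show "(A * B) $$ (i, i) = A $$ (i, i) * B $$ (i, i)" if i: "i < n"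
  proof -
    have "(A * B) $$ (i, i) = (\<Sum>l<n. A $$ (i, l) * B $$ (l, i))"
      by (rule index_mult_mat_sum[OF A(1) B(1) i i])
    also have "\<dots> = (\<Sum>l\<in>{i}. A $$ (i, l) * B $$ (l, i))"
      using i zero by (intro sum.mono_neutral_right) (auto simp: neq_iff)
    finally show ?thesis by simp
  qed
qed

lemma upper_triangular_pow:
  fixes B :: "'a::semiring_1 mat"
  assumes "B \<in> carrier_mat n n" "upper_triangular B"
  shows "upper_triangular (B ^\<^sub>m p) \<and> (\<forall>i<n. (B ^\<^sub>m p) $$ (i, i) = (B $$ (i, i)) ^ p)"
proof (induction p)
  case (Suc p)
  have Bp: "B ^\<^sub>m p \<in> carrier_mat n n" using assms(1) by simp
  have "upper_triangular (B ^\<^sub>m p * B)"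
    using upper_triangular_mult(1)[OF Bp _ assms] Suc by blast
  moreover have "(B ^\<^sub>m p * B) $$ (i, i) = B $$ (i, i) ^ Suc p" if "i < n" for i
    using upper_triangular_mult(2)[OF Bp _ assms that] Suc that by (simp only: power_Suc2)
  ultimately show ?case by (simp only: pow_mat.simps) blast
qed (use assms in \<open>auto simp: upper_triangular_def\<close>)

text \<open>After Schur triangularization the diagonal of the p-th power carries the p-th powers of
  the eigenvalues, counted with multiplicity, and the trace is unchanged by cyclicity.\<close>

lemma mat_Tr_pow_eq_sum_eigenvalues:
  fixes A :: "complex mat"
  assumes A: "A \<in> carrier_mat n n"
  obtains e :: "nat \<Rightarrow> complex" where "\<And>p. mat_Tr (A ^\<^sub>m p) = (\<Sum>i<n. e i ^ p)"
    and "\<And>i. i < n \<Longrightarrow> eigenvalue A (e i)"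
proof -
  obtain es where es: "char_poly A = (\<Prod>a\<leftarrow>es. [:- a, 1:])" "length es = n"
    using char_poly_factorized[OF A] by blast
  obtain B P Q where BPQ: "schur_decomposition A es = (B, P, Q)" by (cases "schur_decomposition A es") auto
  from schur_decomposition[OF A es(1) BPQ]
  have wit: "similar_mat_wit A B P Q" and B: "upper_triangular B" and diag: "diag_mat B = es" by auto
  note c = similar_mat_witD2[OF A wit]
  have B_diag: "B $$ (i, i) = es ! i" if "i < n" for i
    using that c(5) unfolding diag[symmetric] diag_mat_def by simp
  show thesis
  proof (rule that[of "\<lambda>i. es ! i"])
    fix p
    have Bp: "B ^\<^sub>m p \<in> carrier_mat n n" using c(5) by simp
    have "mat_Tr (A ^\<^sub>m p) = mat_Tr (P * B ^\<^sub>m p * Q)" using similar_mat_wit_pow_id[OF wit] by simp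
    also have "\<dots> = mat_Tr (Q * (P * B ^\<^sub>m p))"
      using c Bp by (intro mat_Tr_mult_commute) auto
    also have "Q * (P * B ^\<^sub>m p) = (Q * P) * B ^\<^sub>m p" using c Bp by (intro assoc_mult_mat[symmetric]) auto
    also have "\<dots> = B ^\<^sub>m p" using c Bp by simp
    also have "mat_Tr (B ^\<^sub>m p) = (\<Sum>i<n. es ! i ^ p)"
      using upper_triangular_pow[OF c(5) B, of p] c(5) B_diag by (simp add: mat_Tr_def)
    finally show "mat_Tr (A ^\<^sub>m p) = (\<Sum>i<n. es ! i ^ p)" .
  next
    fix i assume "i < n"
    then have "es ! i \<in> set es" using es(2) by simp
    then have "poly (char_poly A) (es ! i) = 0" unfolding es(1) poly_prod_list
      by (auto simp: prod_list_zero_iff)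
    then show "eigenvalue A (es ! i)" using eigenvalue_root_char_poly[OF A] by simp
  qed
qed

section \<open>Euclidean norm, operator norm and eigenvalues of Gram matrices\<close>

lemma euclidean_norm_sq: "complex_of_real ((euclidean_norm v)\<^sup>2) = v \<bullet>c v"
proof -
  have "v \<bullet>c v = (\<Sum>i<dim_vec v. vec_index v i * cnj (vec_index v i))"
    by (simp add: scalar_prod_def atLeast0LessThan)
  also have "\<dots> = (\<Sum>i<dim_vec v. complex_of_real ((cmod (vec_index v i))\<^sup>2))"
    by (simp only: complex_norm_square)
  also have "\<dots> = complex_of_real ((euclidean_norm v)\<^sup>2)"
    by (simp add: euclidean_norm_def L2_set_def sum_nonneg)
  finally show ?thesis by simp
qed

lemma euclidean_norm_nonneg: "0 \<le> euclidean_norm v"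
  by (simp add: euclidean_norm_def)

lemma cscalar_prod_adjoint:
  fixes A :: "complex mat"
  assumes A: "A \<in> carrier_mat n m" and "v \<in> carrier_vec m" "w \<in> carrier_vec n"
  shows "(A *\<^sub>v v) \<bullet>c w = v \<bullet>c (mat_adjoint A *\<^sub>v w)"
proof -
  have "(A *\<^sub>v v) \<bullet>c w = (\<Sum>i<n. \<Sum>l<m. A $$ (i, l) * vec_index v l * cnj (vec_index w i))"
    using assms by (simp add: scalar_prod_def atLeast0LessThan sum_distrib_right)
  also have "\<dots> = (\<Sum>l<m. \<Sum>i<n. vec_index v l * (A $$ (i, l) * cnj (vec_index w i)))"
    by (subst sum.swap) (simp add: mult_ac)
  also have "\<dots> = (\<Sum>l<m. vec_index v l * cnj (\<Sum>i<n. mat_adjoint A $$ (l, i) * vec_index w i))"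
    using assms by (simp add: index_mat_adjoint sum_distrib_left)
  also have "\<dots> = v \<bullet>c (mat_adjoint A *\<^sub>v w)"
    using assms by (simp add: scalar_prod_def atLeast0LessThan)
  finally show ?thesis .
qed

lemma norm_cscalar_prod_le:
  assumes "v \<in> carrier_vec n" "w \<in> carrier_vec n"
  shows "cmod (v \<bullet>c w) \<le> euclidean_norm v * euclidean_norm w"
proof -
  have "cmod (v \<bullet>c w) \<le> (\<Sum>i<n. \<bar>cmod (vec_index v i)\<bar> * \<bar>cmod (vec_index w i)\<bar>)"
    using assms by (auto simp: scalar_prod_def atLeast0LessThan norm_mult intro!: order_trans[OF norm_sum])
  also have "\<dots> \<le> euclidean_norm v * euclidean_norm w"
    using L2_set_mult_ineq[of "\<lambda>i. cmod (vec_index v i)" "\<lambda>i. cmod (vec_index w i)" "{..<n}"] assms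
    by (simp add: euclidean_norm_def)
  finally show ?thesis .
qed

text \<open>Cauchy-Schwarz row by row. It makes the supremum in \<open>mat_opnorm\<close> finite,
  and for a power of a hermitian matrix it compares the norm with a trace.\<close>

lemma euclidean_norm_mult_vec_le_frobenius:
  assumes A: "A \<in> carrier_mat n m" and v: "v \<in> carrier_vec m"
  shows "(euclidean_norm (A *\<^sub>v v))\<^sup>2 \<le> (\<Sum>i<n. \<Sum>j<m. (cmod (A $$ (i, j)))\<^sup>2) * (euclidean_norm v)\<^sup>2"
proof -
  have "(euclidean_norm (A *\<^sub>v v))\<^sup>2 = (\<Sum>i<n. (cmod (vec_index (A *\<^sub>v v) i))\<^sup>2)"
    using A by (simp add: euclidean_norm_def L2_set_def sum_nonneg)
  also have "\<dots> \<le> (\<Sum>i<n. (\<Sum>j<m. (cmod (A $$ (i, j)))\<^sup>2) * (euclidean_norm v)\<^sup>2)"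
  proof (rule sum_mono)
    fix i assume i: "i \<in> {..<n}"
    have "cmod (vec_index (A *\<^sub>v v) i) \<le> (\<Sum>j<m. \<bar>cmod (A $$ (i, j))\<bar> * \<bar>cmod (vec_index v j)\<bar>)"
      using i by (subst index_mult_mat_vec_sum[OF A v]) (auto simp: norm_mult intro!: order_trans[OF norm_sum])
    also have "\<dots> \<le> L2_set (\<lambda>j. cmod (A $$ (i, j))) {..<m} * euclidean_norm v"
      using L2_set_mult_ineq[of "\<lambda>j. cmod (A $$ (i, j))" "\<lambda>j. cmod (vec_index v j)" "{..<m}"] v
      by (simp add: euclidean_norm_def)
    finally have "(cmod (vec_index (A *\<^sub>v v) i))\<^sup>2
        \<le> (L2_set (\<lambda>j. cmod (A $$ (i, j))) {..<m} * euclidean_norm v)\<^sup>2"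
      by (intro power_mono) auto
    then show "(cmod (vec_index (A *\<^sub>v v) i))\<^sup>2 \<le> (\<Sum>j<m. (cmod (A $$ (i, j)))\<^sup>2) * (euclidean_norm v)\<^sup>2"
      by (simp add: power_mult_distrib L2_set_def sum_nonneg)
  qed
  finally show ?thesis by (simp add: sum_distrib_right)
qed

lemma bdd_above_mat_opnorm:
  "bdd_above ((\<lambda>v. euclidean_norm (A *\<^sub>v v)) ` {v \<in> carrier_vec (dim_col A). euclidean_norm v \<le> 1})"
proof (rule bdd_aboveI2)
  let ?F = "\<Sum>i<dim_row A. \<Sum>j<dim_col A. (cmod (A $$ (i, j)))\<^sup>2"
  fix v assume v: "v \<in> {v \<in> carrier_vec (dim_col A). euclidean_norm v \<le> 1}"
  have F0: "0 \<le> ?F" by (intro sum_nonneg) auto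
  have "(euclidean_norm (A *\<^sub>v v))\<^sup>2 \<le> ?F * (euclidean_norm v)\<^sup>2"
    using v by (intro euclidean_norm_mult_vec_le_frobenius) auto
  also have "\<dots> \<le> ?F * 1"
    using v euclidean_norm_nonneg[of v] by (intro mult_left_mono F0) (auto intro: power_le_one)
  finally show "euclidean_norm (A *\<^sub>v v) \<le> sqrt ?F" by (simp add: real_le_rsqrt)
qed

lemma euclidean_norm_smult: "euclidean_norm (c \<cdot>\<^sub>v v) = cmod c * euclidean_norm v"
proof -
  have "euclidean_norm (c \<cdot>\<^sub>v v) = L2_set (\<lambda>i. cmod c * cmod (vec_index v i)) {..<dim_vec v}"
    unfolding euclidean_norm_def by (intro L2_set_cong) (auto simp: norm_mult)
  then show ?thesis by (simp add: euclidean_norm_def L2_set_right_distrib)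
qed

lemma euclidean_norm_0: "euclidean_norm (0\<^sub>v n) = 0"
  by (simp add: euclidean_norm_def L2_set_def)

lemma euclidean_norm_eq_0_iff: "v \<in> carrier_vec n \<Longrightarrow> euclidean_norm v = 0 \<longleftrightarrow> v = 0\<^sub>v n"
  by (auto simp: euclidean_norm_def L2_set_eq_0_iff)

lemma mat_opnorm_le_iff:
  assumes A: "A \<in> carrier_mat n m" and c: "0 \<le> c"
  shows "mat_opnorm A \<le> c \<longleftrightarrow> (\<forall>v\<in>carrier_vec m. euclidean_norm (A *\<^sub>v v) \<le> c * euclidean_norm v)"
proof
  have m: "dim_col A = m" using A by simp
  assume le: "mat_opnorm A \<le> c"
  show "\<forall>v\<in>carrier_vec m. euclidean_norm (A *\<^sub>v v) \<le> c * euclidean_norm v"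
  proof
    fix v :: "complex Matrix.vec" assume v: "v \<in> carrier_vec m"
    show "euclidean_norm (A *\<^sub>v v) \<le> c * euclidean_norm v"
    proof (cases "euclidean_norm v = 0")
      case True
      then have "v = 0\<^sub>v m" using euclidean_norm_eq_0_iff[OF v] by simp
      moreover have "A *\<^sub>v 0\<^sub>v m = 0\<^sub>v n" using A by (intro eq_vecI) auto
      ultimately show ?thesis by (simp add: euclidean_norm_0)
    next
      case False
      then have pos: "0 < euclidean_norm v" using euclidean_norm_nonneg[of v] by simp
      define d where "d = complex_of_real (1 / euclidean_norm v)"
      have d: "cmod d = 1 / euclidean_norm v" unfolding d_def norm_of_real using pos by simp
      have "d \<cdot>\<^sub>v v \<in> {v \<in> carrier_vec (dim_col A). euclidean_norm v \<le> 1}"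
        using v m pos d by (simp add: euclidean_norm_smult)
      then have "euclidean_norm (A *\<^sub>v (d \<cdot>\<^sub>v v)) \<le> mat_opnorm A"
        unfolding mat_opnorm_def by (intro cSUP_upper bdd_above_mat_opnorm)
      also have "A *\<^sub>v (d \<cdot>\<^sub>v v) = d \<cdot>\<^sub>v (A *\<^sub>v v)" using A v by (rule mult_mat_vec)
      finally have "1 / euclidean_norm v * euclidean_norm (A *\<^sub>v v) \<le> c"
        using le by (simp add: euclidean_norm_smult d)
      then show ?thesis using pos by (simp add: field_simps)
    qed
  qed
next
  assume le: "\<forall>v\<in>carrier_vec m. euclidean_norm (A *\<^sub>v v) \<le> c * euclidean_norm v"
  show "mat_opnorm A \<le> c"
    unfolding mat_opnorm_def
  proof (rule cSUP_least)
    have "0\<^sub>v (dim_col A) \<in> {v \<in> carrier_vec (dim_col A). euclidean_norm v \<le> 1}"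
      by (simp add: euclidean_norm_0)
    then show "{v \<in> carrier_vec (dim_col A). euclidean_norm v \<le> 1} \<noteq> {}" by blast
    fix v assume v: "v \<in> {v \<in> carrier_vec (dim_col A). euclidean_norm v \<le> 1}"
    then have "euclidean_norm (A *\<^sub>v v) \<le> c * euclidean_norm v" using le A by simp
    also have "\<dots> \<le> c * 1" using v c by (intro mult_left_mono) auto
    finally show "euclidean_norm (A *\<^sub>v v) \<le> c" by simp
  qed
qed

text \<open>If b < a, the powers of b/a tend to 0 and defeat any constant. This removes dimension
  factors from trace estimates.\<close>

lemma le_of_power_le_const_mult_power:
  fixes a b c :: real
  assumes "0 \<le> b" and "filterlim k sequentially sequentially" and "\<And>i. a ^ k i \<le> c * b ^ k i"
  shows "a \<le> b"
proof (rule ccontr)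
  assume "\<not> a \<le> b"
  then have ab: "b < a" by simp
  then have "(\<lambda>i. (b / a) ^ i) \<longlonglongrightarrow> 0" using assms(1) by (intro LIMSEQ_realpow_zero) auto
  then have "(\<lambda>i. c * (b / a) ^ k i) \<longlonglongrightarrow> c * 0"
    by (intro tendsto_mult_left filterlim_compose[OF _ assms(2)])
  then have "\<forall>\<^sub>F i in sequentially. c * (b / a) ^ k i < 1" by (rule order_tendstoD) simp
  then obtain i where "c * (b / a) ^ k i < 1" by (auto simp: eventually_sequentially)
  moreover have "0 < a ^ k i" using ab assms(1) by simp
  ultimately have "c * b ^ k i < a ^ k i" by (simp add: power_divide divide_simps)
  then show False using assms(3)[of i] by simp
qed

lemma mat_Tr_adjoint_mult:
  assumes "Y \<in> carrier_mat n m"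
  shows "mat_Tr (mat_adjoint Y * Y) = complex_of_real (\<Sum>i<n. \<Sum>j<m. (cmod (Y $$ (i, j)))\<^sup>2)"
proof -
  have "mat_Tr (mat_adjoint Y * Y) = (\<Sum>j<m. \<Sum>i<n. complex_of_real ((cmod (Y $$ (i, j)))\<^sup>2))"
    unfolding mat_Tr_def using assms
  proof (intro sum.cong)
    fix j assume j: "j \<in> {..<m}"
    have "(mat_adjoint Y * Y) $$ (j, j) = (\<Sum>i<n. mat_adjoint Y $$ (j, i) * Y $$ (i, j))"
      using assms j by (intro index_mult_mat_sum) auto
    also have "\<dots> = (\<Sum>i<n. complex_of_real ((cmod (Y $$ (i, j)))\<^sup>2))"
      using assms j unfolding complex_norm_square
      by (intro sum.cong refl) (simp add: index_mat_adjoint mult.commute[of "cnj _"])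
    finally show "(mat_adjoint Y * Y) $$ (j, j) = (\<Sum>i<n. complex_of_real ((cmod (Y $$ (i, j)))\<^sup>2))" .
  qed simp
  then show ?thesis by (subst (asm) sum.swap) simp
qed

lemma mat_adjoint_adjoint: "mat_adjoint (mat_adjoint A) = (A :: complex mat)"
  by (rule eq_matI) (simp_all add: index_mat_adjoint)

lemma mat_adjoint_mult:
  fixes A B :: "complex mat"
  assumes "A \<in> carrier_mat n m" "B \<in> carrier_mat m k"
  shows "mat_adjoint (A * B) = mat_adjoint B * mat_adjoint A"
proof (rule eq_matI)
  fix i j assume "i < dim_row (mat_adjoint B * mat_adjoint A)" "j < dim_col (mat_adjoint B * mat_adjoint A)"
  then have ij: "i < k" "j < n" using assms by auto
  have "mat_adjoint (A * B) $$ (i, j) = cnj (\<Sum>l<m. A $$ (j, l) * B $$ (l, i))"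
    using assms ij by (subst index_mat_adjoint) (auto simp: index_mult_mat_sum[OF assms] simp del: index_mult_mat(1))
  also have "\<dots> = (\<Sum>l<m. mat_adjoint B $$ (i, l) * mat_adjoint A $$ (l, j))"
    using assms ij by (simp add: index_mat_adjoint mult.commute)
  also have "\<dots> = (mat_adjoint B * mat_adjoint A) $$ (i, j)"
    using assms ij by (intro index_mult_mat_sum[symmetric]) auto
  finally show "mat_adjoint (A * B) $$ (i, j) = (mat_adjoint B * mat_adjoint A) $$ (i, j)" .
qed (use assms in auto)

lemma mat_adjoint_one: "mat_adjoint (1\<^sub>m n :: complex mat) = 1\<^sub>m n"
  by (rule eq_matI) (auto simp: index_mat_adjoint)

lemma pow_mat_add:
  fixes A :: "'a::semiring_1 mat"
  assumes A: "A \<in> carrier_mat n n"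
  shows "A ^\<^sub>m (p + q) = A ^\<^sub>m p * A ^\<^sub>m q"
proof (induction q)
  case 0
  then show ?case using A right_mult_one_mat[OF pow_carrier_mat[OF A], of p] by simp
next
  case (Suc q)
  then show ?case
    using assoc_mult_mat[OF pow_carrier_mat[OF A, of p] pow_carrier_mat[OF A, of q] A] by simp
qed

lemma mat_adjoint_pow:
  fixes A :: "complex mat"
  assumes A: "A \<in> carrier_mat n n" and herm: "mat_adjoint A = A"
  shows "mat_adjoint (A ^\<^sub>m p) = A ^\<^sub>m p"
proof (induction p)
  case 0
  then show ?case using A by (simp add: mat_adjoint_one)
next
  case (Suc p)
  have "mat_adjoint (A ^\<^sub>m p * A) = A * A ^\<^sub>m p"
    by (subst mat_adjoint_mult[OF pow_carrier_mat[OF A] A]) (simp add: herm Suc)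
  also have "\<dots> = A ^\<^sub>m Suc p" using pow_mat_add[OF A, of 1 p] A by simp
  finally show ?case by simp
qed

text \<open>The largest eigenvalue bounds the norm without unitary diagonalization: Cauchy--Schwarz gives
  \<open>\<parallel>A ^ j v\<parallel>\<^sup>2 \<le> \<parallel>v\<parallel> \<parallel>A ^ (2 j) v\<parallel>\<close>, and \<open>\<parallel>A ^ j v\<parallel>\<^sup>2\<close> is at most the trace of \<open>A ^ (2 j)\<close>.\<close>
lemma hermitian_norm_power_bound:
  fixes A :: "complex mat"
  assumes A: "A \<in> carrier_mat n n" and herm: "mat_adjoint A = A"
    and v: "v \<in> carrier_vec n" "euclidean_norm v = 1"
  shows "(euclidean_norm (A *\<^sub>v v)) ^ (2 ^ k) \<le> euclidean_norm (A ^\<^sub>m (2 ^ k) *\<^sub>v v)"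
proof (induction k)
  case (Suc k)
  let ?B = "A ^\<^sub>m (2 ^ k)"
  have B: "?B \<in> carrier_mat n n" using A by simp
  have Bv: "?B *\<^sub>v v \<in> carrier_vec n" using B v by simp
  have "complex_of_real ((euclidean_norm (?B *\<^sub>v v))\<^sup>2) = (?B *\<^sub>v v) \<bullet>c (?B *\<^sub>v v)"
    by (rule euclidean_norm_sq)
  also have "\<dots> = v \<bullet>c (?B *\<^sub>v (?B *\<^sub>v v))"
    using cscalar_prod_adjoint[OF B v(1) Bv] mat_adjoint_pow[OF A herm] by simp
  also have "?B *\<^sub>v (?B *\<^sub>v v) = A ^\<^sub>m (2 ^ Suc k) *\<^sub>v v"
  proof -
    have "?B *\<^sub>v (?B *\<^sub>v v) = (?B * ?B) *\<^sub>v v" using B v by (simp add: assoc_mult_mat_vec)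
    also have "?B * ?B = A ^\<^sub>m (2 ^ k + 2 ^ k)" by (rule pow_mat_add[OF A, symmetric])
    finally show ?thesis by (simp add: mult_2)
  qed
  finally have "(euclidean_norm (?B *\<^sub>v v))\<^sup>2 = cmod (v \<bullet>c (A ^\<^sub>m (2 ^ Suc k) *\<^sub>v v))"
    by (metis norm_of_real abs_of_nonneg zero_le_power2)
  also have "\<dots> \<le> euclidean_norm v * euclidean_norm (A ^\<^sub>m (2 ^ Suc k) *\<^sub>v v)"
    by (rule norm_cscalar_prod_le[OF v(1) mult_mat_vec_carrier[OF pow_carrier_mat[OF A] v(1)]])
  finally have "(euclidean_norm (?B *\<^sub>v v))\<^sup>2 \<le> euclidean_norm (A ^\<^sub>m (2 ^ Suc k) *\<^sub>v v)" using v by simp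
  moreover have "((euclidean_norm (A *\<^sub>v v)) ^ (2 ^ k))\<^sup>2 \<le> (euclidean_norm (?B *\<^sub>v v))\<^sup>2"
    using Suc euclidean_norm_nonneg by (intro power_mono) auto
  ultimately show ?case by (simp add: power_mult[symmetric] mult.commute)
qed (use A in simp)

text \<open>An eigenvalue of A = X^* X at v is the quotient of the squared norms of X v and v, hence
  real, nonnegative and at most c^2 if X has norm at most c. Conversely, for a unit vector v the
  trace bounds the powers of the norm of A v, and the squared norm of X v is at most that
  norm.\<close>

theorem gram_eigenvalues:
  fixes X :: "complex mat"
  assumes X: "X \<in> carrier_mat n n"
  obtains e :: "nat \<Rightarrow> real" where
    "\<And>p. mat_Tr ((mat_adjoint X * X) ^\<^sub>m p) = complex_of_real (\<Sum>i<n. e i ^ p)"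
    and "\<And>i. i < n \<Longrightarrow> 0 \<le> e i"
    and "\<And>c. 0 \<le> c \<Longrightarrow> mat_opnorm X \<le> c \<longleftrightarrow> (\<forall>i<n. e i \<le> c\<^sup>2)"
proof -
  define A where "A = mat_adjoint X * X"
  have A: "A \<in> carrier_mat n n" unfolding A_def by (rule mult_carrier_mat[OF mat_adjoint_carrier[OF X] X])
  have herm: "mat_adjoint A = A"
    unfolding A_def using X by (subst mat_adjoint_mult[of _ n n]) (auto simp: mat_adjoint_adjoint)
  have quad: "complex_of_real ((euclidean_norm (X *\<^sub>v v))\<^sup>2) = v \<bullet>c (A *\<^sub>v v)" if v: "v \<in> carrier_vec n" for v
  proof -
    have "X *\<^sub>v v \<in> carrier_vec n" using X v by simp
    then have "(X *\<^sub>v v) \<bullet>c (X *\<^sub>v v) = v \<bullet>c (mat_adjoint X *\<^sub>v (X *\<^sub>v v))"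
      by (rule cscalar_prod_adjoint[OF X v])
    also have "mat_adjoint X *\<^sub>v (X *\<^sub>v v) = A *\<^sub>v v"
      unfolding A_def by (rule assoc_mult_mat_vec[OF mat_adjoint_carrier[OF X] X v, symmetric])
    finally show ?thesis by (simp add: euclidean_norm_sq del: of_real_power)
  qed
  obtain e' where Tr: "\<And>p. mat_Tr (A ^\<^sub>m p) = (\<Sum>i<n. e' i ^ p)"
    and ev: "\<And>i. i < n \<Longrightarrow> eigenvalue A (e' i)"
    using mat_Tr_pow_eq_sum_eigenvalues[OF A] by metis
  have eig: "\<exists>v\<in>carrier_vec n. euclidean_norm v \<noteq> 0
      \<and> e' i = complex_of_real ((euclidean_norm (X *\<^sub>v v))\<^sup>2 / (euclidean_norm v)\<^sup>2)" if i: "i < n" for i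
  proof -
    obtain v where v: "v \<in> carrier_vec n" "v \<noteq> 0\<^sub>v n" "A *\<^sub>v v = e' i \<cdot>\<^sub>v v"
      using ev[OF i] A by (auto simp: eigenvalue_def eigenvector_def)
    have nz: "euclidean_norm v \<noteq> 0" using euclidean_norm_eq_0_iff v by blast
    have "complex_of_real ((euclidean_norm (X *\<^sub>v v))\<^sup>2) = v \<bullet>c (e' i \<cdot>\<^sub>v v)"
      using quad[OF v(1)] v(3) by simp
    also have "\<dots> = cnj (e' i) * complex_of_real ((euclidean_norm v)\<^sup>2)"
      unfolding euclidean_norm_sq using v(1) by (simp add: conjugate_smult_vec)
    \<comment> \<open>The conjugate arises because the second argument of the inner product is
      conjugated; as the right side is real, the eigenvalue is real too.\<close>
    finally have "cnj (e' i) = complex_of_real ((euclidean_norm (X *\<^sub>v v))\<^sup>2 / (euclidean_norm v)\<^sup>2)"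
      using nz by (simp add: field_simps)
    then have "e' i = cnj (complex_of_real ((euclidean_norm (X *\<^sub>v v))\<^sup>2 / (euclidean_norm v)\<^sup>2))"
      by (metis complex_cnj_cnj)
    then show ?thesis using v(1) nz by auto
  qed
  define e where "e i = Re (e' i)" for i
  have e: "\<exists>v\<in>carrier_vec n. euclidean_norm v \<noteq> 0 \<and> e i = (euclidean_norm (X *\<^sub>v v))\<^sup>2 / (euclidean_norm v)\<^sup>2
      \<and> e' i = complex_of_real (e i)" if "i < n" for i
    using eig[OF that] unfolding e_def by (metis Re_complex_of_real)
  have e_nonneg: "0 \<le> e i" if "i < n" for i using e[OF that] by auto
  have "e' i = complex_of_real (e i)" if "i < n" for i using e[OF that] by blast
  then have Tr_e: "mat_Tr (A ^\<^sub>m p) = complex_of_real (\<Sum>i<n. e i ^ p)" for p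
    unfolding Tr by simp
  show thesis
  proof (rule that[of e])
    show "mat_Tr ((mat_adjoint X * X) ^\<^sub>m p) = complex_of_real (\<Sum>i<n. e i ^ p)" for p
      using Tr_e[of p] by (simp add: A_def)
    show "0 \<le> e i" if "i < n" for i by (rule e_nonneg[OF that])
    fix c :: real assume c: "0 \<le> c"
    show "mat_opnorm X \<le> c \<longleftrightarrow> (\<forall>i<n. e i \<le> c\<^sup>2)"
    proof
      assume "mat_opnorm X \<le> c"
      then have le: "euclidean_norm (X *\<^sub>v v) \<le> c * euclidean_norm v" if "v \<in> carrier_vec n" for v
        using mat_opnorm_le_iff[OF X c] that by blast
      show "\<forall>i<n. e i \<le> c\<^sup>2"
      proof (intro allI impI)
        fix i assume "i < n"
        then obtain v where v: "v \<in> carrier_vec n" "euclidean_norm v \<noteq> 0"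
          "e i = (euclidean_norm (X *\<^sub>v v))\<^sup>2 / (euclidean_norm v)\<^sup>2" using e by blast
        have "(euclidean_norm (X *\<^sub>v v))\<^sup>2 \<le> (c * euclidean_norm v)\<^sup>2"
          using le[OF v(1)] euclidean_norm_nonneg by (intro power_mono) auto
        moreover have "0 < (euclidean_norm v)\<^sup>2" using v(2) by simp
        ultimately show "e i \<le> c\<^sup>2"
          unfolding v(3) by (simp add: pos_divide_le_eq power_mult_distrib)
      qed
    next
      assume le: "\<forall>i<n. e i \<le> c\<^sup>2"
      have unit: "euclidean_norm (X *\<^sub>v v) \<le> c" if v: "v \<in> carrier_vec n" "euclidean_norm v = 1" for v
      proof -
        define s where "s = euclidean_norm (A *\<^sub>v v)"
        have pow: "s ^ (2 * 2 ^ k) \<le> real n * (c\<^sup>2) ^ (2 * 2 ^ k)" for k :: nat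
        proof -
          let ?B = "A ^\<^sub>m (2 ^ k)"
          have B: "?B \<in> carrier_mat n n" using A by simp
          have "s ^ (2 * 2 ^ k) = (s ^ (2 ^ k))\<^sup>2" by (simp add: power_mult[symmetric] mult.commute)
          also have "\<dots> \<le> (euclidean_norm (?B *\<^sub>v v))\<^sup>2"
            using hermitian_norm_power_bound[OF A herm v, of k] euclidean_norm_nonneg
            by (intro power_mono) (auto simp: s_def)
          also have "\<dots> \<le> (\<Sum>i<n. \<Sum>j<n. (cmod (?B $$ (i, j)))\<^sup>2) * (euclidean_norm v)\<^sup>2"
            by (rule euclidean_norm_mult_vec_le_frobenius[OF B v(1)])
          also have "\<dots> = (\<Sum>i<n. e i ^ (2 * 2 ^ k))"
          proof -
            have "complex_of_real (\<Sum>i<n. \<Sum>j<n. (cmod (?B $$ (i, j)))\<^sup>2) = mat_Tr (mat_adjoint ?B * ?B)"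
              by (rule mat_Tr_adjoint_mult[OF B, symmetric])
            also have "mat_adjoint ?B * ?B = A ^\<^sub>m (2 ^ k + 2 ^ k)"
              unfolding mat_adjoint_pow[OF A herm] by (rule pow_mat_add[OF A, symmetric])
            finally have "complex_of_real (\<Sum>i<n. \<Sum>j<n. (cmod (?B $$ (i, j)))\<^sup>2)
                = complex_of_real (\<Sum>i<n. e i ^ (2 * 2 ^ k))"
              unfolding Tr_e mult_2 .
            then show ?thesis using v by (simp only: of_real_eq_iff) simp
          qed
          also have "\<dots> \<le> (\<Sum>i<n. (c\<^sup>2) ^ (2 * 2 ^ k))"
            using le e_nonneg by (intro sum_mono power_mono) auto
          finally show ?thesis by simp
        qed
        \<comment> \<open>The dimension n is a constant factor here and vanishes on taking roots
          along the exponents 2 * 2^k.\<close>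
        have "s \<le> c\<^sup>2"
          by (rule le_of_power_le_const_mult_power[OF _ _ pow]) (simp, real_asymp)
        moreover have "(euclidean_norm (X *\<^sub>v v))\<^sup>2 \<le> s"
        proof -
          have "(euclidean_norm (X *\<^sub>v v))\<^sup>2 = cmod (v \<bullet>c (A *\<^sub>v v))"
            using quad[OF v(1)] by (metis norm_of_real abs_of_nonneg zero_le_power2)
          also have "\<dots> \<le> euclidean_norm v * euclidean_norm (A *\<^sub>v v)"
            by (rule norm_cscalar_prod_le[OF v(1) mult_mat_vec_carrier[OF A v(1)]])
          finally show ?thesis using v by (simp add: s_def)
        qed
        ultimately show ?thesis using c by (meson order_trans power2_le_imp_le)
      qed
      show "mat_opnorm X \<le> c"
        unfolding mat_opnorm_le_iff[OF X c]
      proof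
        fix v :: "complex Matrix.vec" assume v: "v \<in> carrier_vec n"
        show "euclidean_norm (X *\<^sub>v v) \<le> c * euclidean_norm v"
        proof (cases "euclidean_norm v = 0")
          case True
          then have "v = 0\<^sub>v n" using euclidean_norm_eq_0_iff[OF v] by simp
          moreover have "X *\<^sub>v 0\<^sub>v n = 0\<^sub>v n" using X by (intro eq_vecI) auto
          ultimately show ?thesis by (simp add: euclidean_norm_0)
        next
          case False
          then have pos: "0 < euclidean_norm v" using euclidean_norm_nonneg[of v] by simp
          define d where "d = complex_of_real (1 / euclidean_norm v)"
          have d: "cmod d = 1 / euclidean_norm v" unfolding d_def norm_of_real using pos by simp
          have "euclidean_norm (X *\<^sub>v (d \<cdot>\<^sub>v v)) \<le> c"
            by (rule unit) (use v pos d in \<open>simp_all add: euclidean_norm_smult\<close>)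
          then have "1 / euclidean_norm v * euclidean_norm (X *\<^sub>v v) \<le> c"
            unfolding mult_mat_vec[OF X v] euclidean_norm_smult d .
          then show ?thesis using pos by (simp add: field_simps)
        qed
      qed
    qed
  qed
qed

section \<open>Random unitary representations\<close>

lemma rep_ext_carrier [simp]: "rep_ext n \<rho> x \<in> carrier_mat n n"
  by (simp add: rep_ext_def)

lemma index_rep_ext:
  "i < n \<Longrightarrow> j < n \<Longrightarrow> rep_ext n \<rho> x $$ (i, j) = ga_linear_ext (\<lambda>g. \<rho> g $$ (i, j)) x"
  by (simp add: rep_ext_def ga_linear_ext_def)

lemma unitary_rep_carrier:
  assumes "unitary_rep n \<rho>"
  shows "\<rho> g \<in> carrier_mat n n"
  using assms by (simp add: unitary_rep_def unitary_mat_def)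

lemma rep_ext_mult:
  fixes x y :: "'g::group_add group_algebra"
  assumes \<rho>: "unitary_rep n \<rho>"
  shows "rep_ext n \<rho> (x * y) = rep_ext n \<rho> x * rep_ext n \<rho> y"
proof (rule eq_matI)
  fix i j assume "i < dim_row (rep_ext n \<rho> x * rep_ext n \<rho> y)" "j < dim_col (rep_ext n \<rho> x * rep_ext n \<rho> y)"
  then have ij: "i < n" "j < n" by (simp_all add: rep_ext_def)
  have mult: "\<rho> (g + h) $$ (i, j) = (\<Sum>l<n. \<rho> g $$ (i, l) * \<rho> h $$ (l, j))" for g h
    using \<rho> index_mult_mat_sum[OF unitary_rep_carrier[OF \<rho>] unitary_rep_carrier[OF \<rho>] ij]
    by (simp add: unitary_rep_def)
  have "rep_ext n \<rho> (x * y) $$ (i, j) = (\<Sum>g\<in>Poly_Mapping.keys x. \<Sum>h\<in>Poly_Mapping.keys y. \<Sum>l<n.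
      (Poly_Mapping.lookup x g * \<rho> g $$ (i, l)) * (Poly_Mapping.lookup y h * \<rho> h $$ (l, j)))"
    unfolding index_rep_ext[OF ij] ga_linear_ext_mult mult
    by (simp add: ga_linear_ext_def sum_distrib_left mult_ac)
  also have "\<dots> = (\<Sum>g\<in>Poly_Mapping.keys x. \<Sum>l<n. \<Sum>h\<in>Poly_Mapping.keys y.
      (Poly_Mapping.lookup x g * \<rho> g $$ (i, l)) * (Poly_Mapping.lookup y h * \<rho> h $$ (l, j)))"
    by (intro sum.cong refl sum.swap)
  also have "\<dots> = (\<Sum>l<n. \<Sum>g\<in>Poly_Mapping.keys x. \<Sum>h\<in>Poly_Mapping.keys y.
      (Poly_Mapping.lookup x g * \<rho> g $$ (i, l)) * (Poly_Mapping.lookup y h * \<rho> h $$ (l, j)))"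
    by (rule sum.swap)
  also have "\<dots> = (\<Sum>l<n. rep_ext n \<rho> x $$ (i, l) * rep_ext n \<rho> y $$ (l, j))"
    using ij by (intro sum.cong refl) (simp add: index_rep_ext ga_linear_ext_def sum_product)
  also have "\<dots> = (rep_ext n \<rho> x * rep_ext n \<rho> y) $$ (i, j)"
    by (rule index_mult_mat_sum[OF rep_ext_carrier rep_ext_carrier ij, symmetric])
  finally show "rep_ext n \<rho> (x * y) $$ (i, j) = (rep_ext n \<rho> x * rep_ext n \<rho> y) $$ (i, j)" .
qed (simp_all add: rep_ext_def)

lemma unitary_rep_uminus:
  fixes \<rho> :: "'g::group_add \<Rightarrow> complex mat"
  assumes \<rho>: "unitary_rep n \<rho>"
  shows "\<rho> (- g) = mat_adjoint (\<rho> g)"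
proof -
  note c = unitary_rep_carrier[OF \<rho>]
  have u: "\<rho> g * mat_adjoint (\<rho> g) = 1\<^sub>m n" and "\<rho> (- g + g) = \<rho> (- g) * \<rho> g"
    using \<rho> unfolding unitary_rep_def unitary_mat_def by blast+
  then have left: "\<rho> (- g) * \<rho> g = 1\<^sub>m n" using \<rho> by (simp add: unitary_rep_def)
  have "\<rho> (- g) = \<rho> (- g) * (\<rho> g * mat_adjoint (\<rho> g))" using c[of "- g"] by (simp add: u)
  also have "\<dots> = (\<rho> (- g) * \<rho> g) * mat_adjoint (\<rho> g)"
    by (rule assoc_mult_mat[OF c c mat_adjoint_carrier[OF c], symmetric])
  also have "\<dots> = 1\<^sub>m n * mat_adjoint (\<rho> g)" unfolding left ..
  also have "\<dots> = mat_adjoint (\<rho> g)" by (rule left_mult_one_mat[OF mat_adjoint_carrier[OF c]])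
  finally show ?thesis .
qed

lemma rep_ext_star:
  fixes x :: "'g::group_add group_algebra"
  assumes \<rho>: "unitary_rep n \<rho>"
  shows "rep_ext n \<rho> (ga_star x) = mat_adjoint (rep_ext n \<rho> x)"
proof (rule eq_matI)
  fix i j assume "i < dim_row (mat_adjoint (rep_ext n \<rho> x))" "j < dim_col (mat_adjoint (rep_ext n \<rho> x))"
  then have ij: "i < n" "j < n" by (simp_all add: rep_ext_def)
  have "\<rho> (- g) $$ (i, j) = cnj (\<rho> g $$ (j, i))" for g
    unfolding unitary_rep_uminus[OF \<rho>] using ij unitary_rep_carrier[OF \<rho>, of g]
    by (intro index_mat_adjoint) auto
  then have "rep_ext n \<rho> (ga_star x) $$ (i, j) = cnj (rep_ext n \<rho> x $$ (j, i))"
    unfolding index_rep_ext[OF ij] index_rep_ext[OF ij(2,1)] ga_linear_ext_star by (simp add: ga_linear_ext_def)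
  then show "rep_ext n \<rho> (ga_star x) $$ (i, j) = mat_adjoint (rep_ext n \<rho> x) $$ (i, j)"
    using ij by (subst index_mat_adjoint) (auto simp: rep_ext_def)
qed (simp_all add: rep_ext_def)

lemma rep_ext_power:
  fixes y :: "'g::group_add group_algebra"
  assumes \<rho>: "unitary_rep n \<rho>"
  shows "rep_ext n \<rho> (y ^ p) = rep_ext n \<rho> y ^\<^sub>m p"
proof (induction p)
  case 0
  have "rep_ext n \<rho> 1 = 1\<^sub>m n"
    using \<rho> by (intro eq_matI) (auto simp: index_rep_ext ga_linear_ext_1 unitary_rep_def rep_ext_def[of n \<rho> 1])
  then show ?case by (simp add: rep_ext_def)
next
  case (Suc p)
  have "rep_ext n \<rho> (y ^ Suc p) = rep_ext n \<rho> (y ^ p) * rep_ext n \<rho> y"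
    unfolding power_Suc2 by (rule rep_ext_mult[OF \<rho>])
  then show ?case using Suc by simp
qed

lemma ga_linear_ext_normalized_trace:
  assumes \<rho>: "unitary_rep n \<rho>"
  shows "ga_linear_ext (\<lambda>g. normalized_trace (\<rho> g)) x = mat_Tr (rep_ext n \<rho> x) / of_nat n"
proof -
  have d: "dim_row (\<rho> g) = n" for g using unitary_rep_carrier[OF \<rho>, of g] by auto
  have "mat_Tr (rep_ext n \<rho> x) = (\<Sum>i<n. \<Sum>g\<in>Poly_Mapping.keys x. Poly_Mapping.lookup x g * \<rho> g $$ (i, i))"
    by (simp add: mat_Tr_def rep_ext_def)
  also have "\<dots> = (\<Sum>g\<in>Poly_Mapping.keys x. \<Sum>i<n. Poly_Mapping.lookup x g * \<rho> g $$ (i, i))"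
    by (rule sum.swap)
  finally show ?thesis
    by (simp add: ga_linear_ext_def normalized_trace_def d sum_divide_distrib sum_distrib_left)
qed

text \<open>The rows of a unitary matrix are unit vectors, so each diagonal entry has modulus at
  most 1.\<close>

lemma norm_normalized_trace_unitary_le:
  assumes U: "unitary_mat n U"
  shows "cmod (normalized_trace U) \<le> 1"
proof -
  have c: "U \<in> carrier_mat n n" and u: "U * mat_adjoint U = 1\<^sub>m n" using U by (auto simp: unitary_mat_def)
  have entry: "cmod (U $$ (i, i)) \<le> 1" if i: "i < n" for i
  proof -
    have "(U * mat_adjoint U) $$ (i, i) = (\<Sum>j<n. U $$ (i, j) * mat_adjoint U $$ (j, i))"
      by (rule index_mult_mat_sum[OF c mat_adjoint_carrier[OF c] i i])
    also have "\<dots> = (\<Sum>j<n. complex_of_real ((cmod (U $$ (i, j)))\<^sup>2))"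
      unfolding complex_norm_square using c i by (intro sum.cong refl) (simp add: index_mat_adjoint)
    finally have "complex_of_real (\<Sum>j<n. (cmod (U $$ (i, j)))\<^sup>2) = complex_of_real 1"
      unfolding u using i by simp
    then have "(\<Sum>j<n. (cmod (U $$ (i, j)))\<^sup>2) = 1" by (simp only: of_real_eq_iff)
    moreover have "(cmod (U $$ (i, i)))\<^sup>2 \<le> (\<Sum>j<n. (cmod (U $$ (i, j)))\<^sup>2)"
      using i by (intro member_le_sum) auto
    ultimately show ?thesis by (simp add: power2_le_imp_le[of _ 1])
  qed
  have "cmod (\<Sum>i<n. U $$ (i, i)) \<le> (\<Sum>i<n. 1)"
    by (rule order_trans[OF norm_sum sum_mono]) (use entry in simp)
  then have "cmod (\<Sum>i<n. U $$ (i, i)) / real n \<le> 1" by (cases "n = 0") (auto simp: divide_simps)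
  moreover have "dim_row U = n" using c by simp
  ultimately show ?thesis by (simp add: normalized_trace_def norm_divide)
qed

section \<open>Spectrum of the image of a positive element\<close>

lemma word_length_UNIV_le: "word_length UNIV g \<le> 1"
  using word_length_le[of "[g]" UNIV] by (simp add: words_def)

lemma generates_UNIV: "generates UNIV"
  unfolding generates_def by (intro allI bexI[of _ "[_]"]) (auto simp: words_def)

text \<open>This translates between trace moments and eigenvalues of the Gram matrix of \<rho>(x).
  The upper bound for \<open>e i\<close> comes from its p-th power being at most n times the p-th
  trace moment. Using the whole group as generating set, with R = 1, makes the power estimate free
  of \<open>S\<close>.\<close>

lemma unitary_rep_gram_spectrum:
  fixes x :: "'g::group_add group_algebra"
  assumes \<rho>: "unitary_rep n \<rho>" and n: "1 \<le> n"
  defines "y \<equiv> ga_star x * x"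
  obtains e :: "nat \<Rightarrow> real" where
    "\<And>p. ga_linear_ext (\<lambda>g. normalized_trace (\<rho> g)) (y ^ p) = complex_of_real ((\<Sum>i<n. e i ^ p) / real n)"
    and "\<And>i. i < n \<Longrightarrow> 0 \<le> e i" and "\<And>i. i < n \<Longrightarrow> e i \<le> ga_l1_norm y"
    and "\<And>c. 0 \<le> c \<Longrightarrow> mat_opnorm (rep_ext n \<rho> x) \<le> c \<longleftrightarrow> (\<forall>i<n. e i \<le> c\<^sup>2)"
proof -
  obtain e where e: "\<And>p. mat_Tr ((mat_adjoint (rep_ext n \<rho> x) * rep_ext n \<rho> x) ^\<^sub>m p) = complex_of_real (\<Sum>i<n. e i ^ p)"
    "\<And>i. i < n \<Longrightarrow> 0 \<le> e i"
    "\<And>c. 0 \<le> c \<Longrightarrow> mat_opnorm (rep_ext n \<rho> x) \<le> c \<longleftrightarrow> (\<forall>i<n. e i \<le> c\<^sup>2)"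
    using gram_eigenvalues[OF rep_ext_carrier[of n \<rho> x]] by blast
  have tr: "ga_linear_ext (\<lambda>g. normalized_trace (\<rho> g)) (y ^ p) = complex_of_real ((\<Sum>i<n. e i ^ p) / real n)" for p
    unfolding ga_linear_ext_normalized_trace[OF \<rho>] rep_ext_power[OF \<rho>] y_def rep_ext_mult[OF \<rho>] rep_ext_star[OF \<rho>] e(1)
    by simp
  have le: "e i \<le> ga_l1_norm y" if i: "i < n" for i
  proof (rule le_of_power_le_const_mult_power[OF _ filterlim_ident])
    fix p :: nat
    have "cmod (ga_linear_ext (\<lambda>g. normalized_trace (\<rho> g)) (y ^ p)) \<le> ga_l1_norm y ^ p * 1"
      using \<rho> word_length_UNIV_le
      by (intro norm_ga_linear_ext_power_le[OF generates_UNIV] norm_normalized_trace_unitary_le)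
        (auto simp: unitary_rep_def)
    then have "\<bar>(\<Sum>i<n. e i ^ p) / real n\<bar> \<le> ga_l1_norm y ^ p"
      unfolding tr norm_of_real by (simp only: mult_1_right)
    then have "(\<Sum>i<n. e i ^ p) / real n \<le> ga_l1_norm y ^ p" by (rule order_trans[OF abs_ge_self])
    moreover have "e i ^ p \<le> (\<Sum>i<n. e i ^ p)" using i e(2) by (intro member_le_sum) auto
    ultimately show "e i ^ p \<le> real n * ga_l1_norm y ^ p" using n by (simp add: divide_simps mult.commute)
  qed (rule ga_l1_norm_nonneg)
  show thesis by (rule that[OF tr e(2) le e(3)])
qed

text \<open>For moments of an eigenvalue distribution the functional is the normalized trace of h,
  an average of point evaluations.\<close>

lemma moment_sum_powers:
  "moment (\<lambda>p. complex_of_real ((\<Sum>i<n. e i ^ p) / real n)) h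
    = complex_of_real ((\<Sum>i<n. poly h (e i)) / real n)"
proof -
  have "moment (\<lambda>p. complex_of_real ((\<Sum>i<n. e i ^ p) / real n)) h
      = complex_of_real (\<Sum>p\<le>Polynomial.degree h. coeff h p * ((\<Sum>i<n. e i ^ p) / real n))"
    unfolding moment_def of_real_sum of_real_mult ..
  also have "(\<Sum>p\<le>Polynomial.degree h. coeff h p * ((\<Sum>i<n. e i ^ p) / real n))
      = (\<Sum>p\<le>Polynomial.degree h. coeff h p * (\<Sum>i<n. e i ^ p)) / real n"
    by (simp only: times_divide_eq_right sum_divide_distrib[of _ "{..Polynomial.degree h}"])
  also have "(\<Sum>p\<le>Polynomial.degree h. coeff h p * (\<Sum>i<n. e i ^ p)) = (\<Sum>i<n. poly h (e i))"
    unfolding poly_altdef sum_distrib_left by (rule sum.swap)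
  finally show ?thesis .
qed

section \<open>Expectations and probabilities in a fixed dimension\<close>

context
  fixes M :: "'w measure" and n :: nat and \<rho> :: "'w \<Rightarrow> 'g::group_add \<Rightarrow> complex mat"
  assumes random: "random_unitary_rep M n \<rho>" and n: "1 \<le> n"
begin

interpretation prob_space M
  using random by (simp add: random_unitary_rep_def)

lemma unitary_rep_at: "\<omega> \<in> space M \<Longrightarrow> unitary_rep n (\<rho> \<omega>)"
  using random by (simp add: random_unitary_rep_def)

lemma borel_measurable_normalized_trace: "(\<lambda>\<omega>. normalized_trace (\<rho> \<omega> g)) \<in> borel_measurable M"
proof -
  have "(\<lambda>\<omega>. (\<Sum>i<n. \<rho> \<omega> g $$ (i, i)) / of_nat n) \<in> borel_measurable M"
    using random by (intro borel_measurable_divide borel_measurable_sum) (auto simp: random_unitary_rep_def)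
  moreover have "normalized_trace (\<rho> \<omega> g) = (\<Sum>i<n. \<rho> \<omega> g $$ (i, i)) / of_nat n" if "\<omega> \<in> space M" for \<omega>
    using unitary_rep_carrier[OF unitary_rep_at[OF that], of g] by (simp add: normalized_trace_def)
  ultimately show ?thesis by (simp cong: measurable_cong)
qed

lemma integrable_normalized_trace: "integrable M (\<lambda>\<omega>. normalized_trace (\<rho> \<omega> g))"
proof (rule integrable_const_bound[where B = 1])
  show "AE \<omega> in M. cmod (normalized_trace (\<rho> \<omega> g)) \<le> 1"
    using unitary_rep_at by (intro AE_I2 norm_normalized_trace_unitary_le) (auto simp: unitary_rep_def)
qed (rule borel_measurable_normalized_trace)

lemma integrable_ga_linear_ext_trace:
  "integrable M (\<lambda>\<omega>. ga_linear_ext (\<lambda>g. normalized_trace (\<rho> \<omega> g)) z)"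
  unfolding ga_linear_ext_def using integrable_normalized_trace by auto

lemma integral_ga_linear_ext_trace:
  "(\<integral>\<omega>. ga_linear_ext (\<lambda>g. normalized_trace (\<rho> \<omega> g)) z \<partial>M)
    = ga_linear_ext (\<lambda>g. \<integral>\<omega>. normalized_trace (\<rho> \<omega> g) \<partial>M) z"
  unfolding ga_linear_ext_def using integrable_normalized_trace by simp

lemma expectation_moment:
  fixes x :: "'g group_algebra" and h :: "real poly"
  defines "y \<equiv> ga_star x * x"
  defines "T \<equiv> \<lambda>\<omega>. moment (\<lambda>p. ga_linear_ext (\<lambda>g. normalized_trace (\<rho> \<omega> g)) (y ^ p)) h"
  shows "integrable M T"
    and "moment (\<lambda>p. ga_linear_ext (\<lambda>g. \<integral>\<omega>. normalized_trace (\<rho> \<omega> g) \<partial>M) (y ^ p)) h = (\<integral>\<omega>. T \<omega> \<partial>M)"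
  unfolding T_def moment_def using integrable_ga_linear_ext_trace
  by (auto simp: integral_ga_linear_ext_trace[symmetric])

text \<open>All eigenvalues lie in [0, K], so the average of h over them is bounded pointwise and
  hence in expectation. This is the a priori bound fed into the interpolation.\<close>

lemma norm_expectation_moment_le:
  fixes x :: "'g group_algebra" and h :: "real poly"
  defines "y \<equiv> ga_star x * x"
  assumes K: "ga_l1_norm y \<le> K" and b: "\<And>t. 0 \<le> t \<Longrightarrow> t \<le> K \<Longrightarrow> \<bar>poly h t\<bar> \<le> b"
  shows "cmod (moment (\<lambda>p. ga_linear_ext (\<lambda>g. \<integral>\<omega>. normalized_trace (\<rho> \<omega> g) \<partial>M) (y ^ p)) h) \<le> b"
proof -
  let ?T = "\<lambda>\<omega>. moment (\<lambda>p. ga_linear_ext (\<lambda>g. normalized_trace (\<rho> \<omega> g)) (y ^ p)) h"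
  have le: "cmod (?T \<omega>) \<le> b" if \<omega>: "\<omega> \<in> space M" for \<omega>
  proof -
    obtain e where e: "\<And>p. ga_linear_ext (\<lambda>g. normalized_trace (\<rho> \<omega> g)) (y ^ p) = complex_of_real ((\<Sum>i<n. e i ^ p) / real n)"
      "\<And>i. i < n \<Longrightarrow> 0 \<le> e i" "\<And>i. i < n \<Longrightarrow> e i \<le> ga_l1_norm y"
      using unitary_rep_gram_spectrum[OF unitary_rep_at[OF \<omega>] n, of x] unfolding y_def by metis
    have "cmod (?T \<omega>) = \<bar>\<Sum>i<n. poly h (e i)\<bar> / real n"
      unfolding e(1) moment_sum_powers norm_of_real by simp
    also have "\<dots> \<le> (\<Sum>i<n. b) / real n"
      using e K by (intro divide_right_mono order_trans[OF sum_abs sum_mono] b) (auto intro: order_trans)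
    also have "\<dots> = b" using n by simp
    finally show ?thesis .
  qed
  have "cmod (\<integral>\<omega>. ?T \<omega> \<partial>M) \<le> (\<integral>\<omega>. cmod (?T \<omega>) \<partial>M)" by (rule integral_norm_bound)
  also have "\<dots> \<le> (\<integral>\<omega>. b \<partial>M)"
    using expectation_moment(1)[of x h] le unfolding y_def by (intro integral_mono integrable_norm) auto
  also have "\<dots> = b" by (simp add: prob_space)
  finally show ?thesis using expectation_moment(2)[of x h] unfolding y_def by simp
qed

text \<open>The normalized power sums of the eigenvalues are all at most c^(2p) exactly when every
  eigenvalue is at most c^2. The event thus becomes a countable intersection of conditions on
  measurable traces.\<close>

lemma opnorm_event_eq:
  fixes x :: "'g group_algebra"
  assumes c: "0 \<le> c"
  shows "{\<omega> \<in> space M. mat_opnorm (rep_ext n (\<rho> \<omega>) x) \<le> c}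
    = (\<Inter>p. {\<omega> \<in> space M. Re (ga_linear_ext (\<lambda>g. normalized_trace (\<rho> \<omega> g)) ((ga_star x * x) ^ p)) \<le> (c\<^sup>2) ^ p})"
proof -
  have "mat_opnorm (rep_ext n (\<rho> \<omega>) x) \<le> c \<longleftrightarrow>
      (\<forall>p. Re (ga_linear_ext (\<lambda>g. normalized_trace (\<rho> \<omega> g)) ((ga_star x * x) ^ p)) \<le> (c\<^sup>2) ^ p)"
    if \<omega>: "\<omega> \<in> space M" for \<omega>
  proof -
    obtain e where e: "\<And>p. ga_linear_ext (\<lambda>g. normalized_trace (\<rho> \<omega> g)) ((ga_star x * x) ^ p)
        = complex_of_real ((\<Sum>i<n. e i ^ p) / real n)"
      "\<And>i. i < n \<Longrightarrow> 0 \<le> e i"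
      "\<And>c. 0 \<le> c \<Longrightarrow> mat_opnorm (rep_ext n (\<rho> \<omega>) x) \<le> c \<longleftrightarrow> (\<forall>i<n. e i \<le> c\<^sup>2)"
      using unitary_rep_gram_spectrum[OF unitary_rep_at[OF \<omega>] n, of x] by metis
    show ?thesis
      unfolding e(3)[OF c] e(1) Re_complex_of_real
    proof (intro iffI allI impI)
      fix p assume le: "\<forall>i<n. e i \<le> c\<^sup>2"
      have "(\<Sum>i<n. e i ^ p) \<le> (\<Sum>i<n. (c\<^sup>2) ^ p)"
        using le e(2) by (intro sum_mono power_mono) auto
      then show "(\<Sum>i<n. e i ^ p) / real n \<le> (c\<^sup>2) ^ p" using n by (simp add: divide_simps mult.commute)
    next
      fix i assume le: "\<forall>p. (\<Sum>i<n. e i ^ p) / real n \<le> (c\<^sup>2) ^ p" and i: "i < n"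
      show "e i \<le> c\<^sup>2"
      proof (rule le_of_power_le_const_mult_power[OF _ filterlim_ident])
        fix p :: nat
        have "e i ^ p \<le> (\<Sum>i<n. e i ^ p)" using i e(2) by (intro member_le_sum) auto
        also have "\<dots> \<le> real n * (c\<^sup>2) ^ p" using spec[OF le, of p] n by (simp add: divide_simps mult.commute)
        finally show "e i ^ p \<le> real n * (c\<^sup>2) ^ p" .
      qed simp
    qed
  qed
  then show ?thesis by auto
qed

lemma opnorm_event_measurable:
  fixes x :: "'g group_algebra"
  assumes c: "0 \<le> c"
  shows "{\<omega> \<in> space M. mat_opnorm (rep_ext n (\<rho> \<omega>) x) \<le> c} \<in> sets M"
  unfolding opnorm_event_eq[OF c]
proof (rule sets.countable_INT')
  have "{\<omega> \<in> space M. Re (ga_linear_ext (\<lambda>g. normalized_trace (\<rho> \<omega> g)) ((ga_star x * x) ^ p)) \<le> (c\<^sup>2) ^ p} \<in> sets M" for p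
  proof -
    have [measurable]: "(\<lambda>\<omega>. ga_linear_ext (\<lambda>g. normalized_trace (\<rho> \<omega> g)) ((ga_star x * x) ^ p)) \<in> borel_measurable M"
      by (rule borel_measurable_integrable[OF integrable_ga_linear_ext_trace])
    show ?thesis by measurable
  qed
  then show "(\<lambda>p. {\<omega> \<in> space M. Re (ga_linear_ext (\<lambda>g. normalized_trace (\<rho> \<omega> g)) ((ga_star x * x) ^ p)) \<le> (c\<^sup>2) ^ p}) ` UNIV \<subseteq> sets M"
    by blast
qed auto

text \<open>On the complementary event some eigenvalue exceeds c^2 and contributes at least 1 to the
  sum of h over the spectrum, while the other contributions are nonnegative. That sum is n times the
  normalized trace, so integrating gives the bound.\<close>

lemma prob_opnorm_ge:
  fixes x :: "'g group_algebra" and h :: "real poly"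
  defines "y \<equiv> ga_star x * x"
  assumes K: "ga_l1_norm y \<le> K" and c: "0 \<le> c"
    and nonneg: "\<And>t. 0 \<le> t \<Longrightarrow> t \<le> K \<Longrightarrow> 0 \<le> poly h t"
    and ge_1: "\<And>t. c\<^sup>2 \<le> t \<Longrightarrow> t \<le> K \<Longrightarrow> 1 \<le> poly h t"
  shows "1 - real n * cmod (moment (\<lambda>p. ga_linear_ext (\<lambda>g. \<integral>\<omega>. normalized_trace (\<rho> \<omega> g) \<partial>M) (y ^ p)) h)
    \<le> prob {\<omega> \<in> space M. mat_opnorm (rep_ext n (\<rho> \<omega>) x) \<le> c}"
proof -
  let ?T = "\<lambda>\<omega>. moment (\<lambda>p. ga_linear_ext (\<lambda>g. normalized_trace (\<rho> \<omega> g)) (y ^ p)) h"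
  let ?G = "{\<omega> \<in> space M. mat_opnorm (rep_ext n (\<rho> \<omega>) x) \<le> c}"
  have G: "?G \<in> sets M" by (rule opnorm_event_measurable[OF c])
  have T: "integrable M ?T" using expectation_moment(1)[of x h] by (simp add: y_def)
  have le: "1 - real n * Re (?T \<omega>) \<le> indicator ?G \<omega>" if \<omega>: "\<omega> \<in> space M" for \<omega>
  proof -
    obtain e where e: "\<And>p. ga_linear_ext (\<lambda>g. normalized_trace (\<rho> \<omega> g)) (y ^ p) = complex_of_real ((\<Sum>i<n. e i ^ p) / real n)"
      "\<And>i. i < n \<Longrightarrow> 0 \<le> e i" "\<And>i. i < n \<Longrightarrow> e i \<le> ga_l1_norm y"
      "\<And>c. 0 \<le> c \<Longrightarrow> mat_opnorm (rep_ext n (\<rho> \<omega>) x) \<le> c \<longleftrightarrow> (\<forall>i<n. e i \<le> c\<^sup>2)"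
      using unitary_rep_gram_spectrum[OF unitary_rep_at[OF \<omega>] n, of x] unfolding y_def by metis
    have T_eq: "real n * Re (?T \<omega>) = (\<Sum>i<n. poly h (e i))"
      unfolding e(1) moment_sum_powers Re_complex_of_real using n by simp
    have eK: "e i \<le> K" if "i < n" for i using e(3)[OF that] K by simp
    have h0: "0 \<le> poly h (e i)" if "i < n" for i by (rule nonneg[OF e(2)[OF that] eK[OF that]])
    show ?thesis
    proof (cases "\<omega> \<in> ?G")
      case True
      have "0 \<le> (\<Sum>i<n. poly h (e i))" using h0 by (intro sum_nonneg) auto
      then show ?thesis using True T_eq by simp
    next
      case False
      then obtain i where i: "i < n" "c\<^sup>2 < e i" using \<omega> e(4)[OF c] by (auto simp: not_le)
      have "1 \<le> poly h (e i)" using i eK by (intro ge_1) auto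
      also have "\<dots> \<le> (\<Sum>i<n. poly h (e i))" using i h0 by (intro member_le_sum) auto
      finally show ?thesis using False T_eq by simp
    qed
  qed
  have "1 - real n * Re (\<integral>\<omega>. ?T \<omega> \<partial>M) = (\<integral>\<omega>. 1 - real n * Re (?T \<omega>) \<partial>M)"
    using T by (simp add: prob_space integral_Re)
  also have "\<dots> \<le> (\<integral>\<omega>. indicator ?G \<omega> \<partial>M)"
  proof (rule integral_mono)
    show "integrable M (indicator ?G :: 'w \<Rightarrow> real)"
      using G by (intro integrable_real_indicator) (auto simp: less_top[symmetric])
  qed (use T le in auto)
  also have "\<dots> = prob ?G" using G by simp
  finally have "1 - real n * Re (\<integral>\<omega>. ?T \<omega> \<partial>M) \<le> prob ?G" .
  moreover have "real n * Re (\<integral>\<omega>. ?T \<omega> \<partial>M) \<le> real n * cmod (\<integral>\<omega>. ?T \<omega> \<partial>M)"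
    by (intro mult_left_mono complex_Re_le_cmod) auto
  moreover have "moment (\<lambda>p. ga_linear_ext (\<lambda>g. \<integral>\<omega>. normalized_trace (\<rho> \<omega> g) \<partial>M) (y ^ p)) h = (\<integral>\<omega>. ?T \<omega> \<partial>M)"
    using expectation_moment(2)[of x h] by (simp add: y_def)
  ultimately show ?thesis by simp
qed

end

section \<open>Growth from the limsup condition, and assembly\<close>

lemma geometric_bound_of_limsup_root:
  fixes a :: "nat \<Rightarrow> real"
  assumes a: "\<And>p. 0 \<le> a p" and r: "0 < r"
    and lim: "limsup (\<lambda>p. ereal (a p powr (1 / real p))) < ereal r"
  obtains D where "\<And>p. a p \<le> D * r ^ p"
proof -
  have "\<forall>\<^sub>F p in sequentially. ereal (a p powr (1 / real p)) < ereal r"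
    by (rule Limsup_lessD[OF lim])
  then obtain P where P: "\<And>p. P \<le> p \<Longrightarrow> a p powr (1 / real p) < r"
    by (auto simp: eventually_sequentially)
  \<comment> \<open>The index 0 is excluded because \<open>1 / real 0\<close> is 0 and the root
    carries no information there; it falls under the finite sum in \<open>D\<close>.\<close>
  have tail: "a p \<le> r ^ p" if p: "P \<le> p" "1 \<le> p" for p
  proof -
    have "a p = (a p powr (1 / real p)) powr real p" using a[of p] p(2) by (simp add: powr_powr)
    also have "\<dots> \<le> r powr real p" using P[OF p(1)] by (intro powr_mono2) auto
    finally show ?thesis using r by (simp add: powr_realpow)
  qed
  define D where "D = 1 + (\<Sum>p\<le>P. a p / r ^ p)"
  have sum0: "0 \<le> (\<Sum>p\<le>P. a p / r ^ p)" using a r by (intro sum_nonneg) auto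
  have "a p \<le> D * r ^ p" for p
  proof (cases "p \<le> P")
    case True
    then have "a p / r ^ p \<le> (\<Sum>p\<le>P. a p / r ^ p)" using a r by (intro member_le_sum) auto
    then have "a p / r ^ p \<le> D" by (simp add: D_def)
    then show ?thesis using r by (simp add: divide_simps)
  next
    case False
    then have "a p \<le> 1 * r ^ p" using tail[of p] by simp
    also have "\<dots> \<le> D * r ^ p" using sum0 r by (intro mult_right_mono) (auto simp: D_def)
    finally show ?thesis .
  qed
  then show thesis by (rule that)
qed

lemma ga_linear_ext_diff_expansion:
  "ga_linear_ext (\<lambda>g. E g - complex_of_real (\<Sum>k<q. u k g / real n ^ k)) z
    = ga_linear_ext E z - (\<Sum>k<q. ga_linear_ext (\<lambda>g. complex_of_real (u k g)) z / of_nat n ^ k)"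
proof -
  have "(\<Sum>g\<in>Poly_Mapping.keys z. Poly_Mapping.lookup z g * (\<Sum>k<q. complex_of_real (u k g) / of_nat n ^ k))
      = (\<Sum>k<q. \<Sum>g\<in>Poly_Mapping.keys z. Poly_Mapping.lookup z g * complex_of_real (u k g) / of_nat n ^ k)"
    unfolding sum_distrib_left by (subst sum.swap) simp
  then show ?thesis
    by (simp add: ga_linear_ext_def right_diff_distrib sum_subtractf sum_divide_distrib)
qed

theorem theorem1p5:
  fixes S :: "'g::group_add set"
    and M :: "nat \<Rightarrow> 'w measure"
    and \<pi> :: "nat \<Rightarrow> 'w \<Rightarrow> 'g \<Rightarrow> complex mat"
    and C :: real
    and u :: "nat \<Rightarrow> 'g \<Rightarrow> real"
  assumes "finite S" and "generates S"
    and "\<And>n. n \<ge> 1 \<Longrightarrow> random_unitary_rep (M n) n (\<pi> n)"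
    and "C \<ge> 1"
    and "\<And>g. complex_of_real (u 0 g) = canonical_trace (left_regular g)"
    and "\<And>g q n. q \<ge> 1 \<Longrightarrow> n \<ge> 1 \<Longrightarrow> q \<ge> word_length S g \<Longrightarrow> real n \<ge> C * real q powr C \<Longrightarrow>
           cmod ((\<integral>\<omega>. normalized_trace (\<pi> n \<omega> g) \<partial>M n)
                 - complex_of_real (\<Sum>k<q. u k g / real n ^ k))
             \<le> (C * real q) powr (C * real q) / real n ^ q"
    and "\<And>x :: 'g group_algebra. ga_selfadjoint x \<Longrightarrow>
           limsup (\<lambda>p. ereal (cmod (ga_linear_ext (\<lambda>g. complex_of_real (u 1 g)) (x ^ p)) powr (1 / real p)))
             \<le> ereal (ell2_opnorm (left_regular_ext x))"
  shows "\<forall>x :: 'g group_algebra. \<forall>\<epsilon>>0.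
           (\<lambda>n. measure (M n)
              {\<omega> \<in> space (M n). mat_opnorm (rep_ext n (\<pi> n \<omega>) x) \<le> ell2_opnorm (left_regular_ext x) + \<epsilon>})
             \<longlonglongrightarrow> 1"
proof (intro allI impI)
  fix x :: "'g group_algebra" and \<epsilon> :: real assume \<epsilon>: "0 < \<epsilon>"
  note A1 = assms(6) and A2 = assms(7)
  define y where "y = ga_star x * x"
  define c where "c = ell2_opnorm (left_regular_ext x)"
  \<comment> \<open>The room between c^2 and r turns the limsup in (A2) into a geometric bound; the
    room between r and r' is what the separating polynomial uses.\<close>
  define r where "r = (c + \<epsilon> / 2)\<^sup>2"
  define r' where "r' = (c + \<epsilon>)\<^sup>2"
  \<comment> \<open>The maximum secures r' \<le> K even if the l1 norm of y is small.\<close>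
  define K where "K = max (ga_l1_norm y) r'"
  \<comment> \<open>The sum is a bound for all word lengths on the support that also makes sense for
    y = 0.\<close>
  define R where "R = (\<Sum>g\<in>Poly_Mapping.keys y. word_length S g)"
  define a where "a n p = ga_linear_ext (\<lambda>g. \<integral>\<omega>. normalized_trace (\<pi> n \<omega> g) \<partial>M n) (y ^ p)" for n p
  define v where "v k p = ga_linear_ext (\<lambda>g. complex_of_real (u k g)) (y ^ p)" for k p
  have c0: "0 \<le> c" by (simp add: c_def ell2_opnorm_left_regular_ext_nonneg)
  have r0: "0 < r" using c0 \<epsilon> by (simp add: r_def)
  have rr': "r < r'" unfolding r_def r'_def using c0 \<epsilon> by (intro power_strict_mono) auto
  have cr: "c\<^sup>2 < r" unfolding r_def using c0 \<epsilon> by (intro power_strict_mono) auto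
  have norm_y: "ell2_opnorm (left_regular_ext y) \<le> c\<^sup>2"
    unfolding y_def c_def by (rule ell2_opnorm_star_mult_le)
  have R: "word_length S g \<le> R" if "g \<in> Poly_Mapping.keys y" for g
    unfolding R_def using that by (intro member_le_sum) auto
  have expansion: "cmod (a n p - (\<Sum>k<q. v k p / of_nat n ^ k))
      \<le> K ^ p * ((C * real q) powr (C * real q) / real n ^ q)"
    if "1 \<le> q" "1 \<le> n" "p * R \<le> q" "C * real q powr C \<le> real n" for q n p
  proof -
    let ?b = "(C * real q) powr (C * real q) / real n ^ q"
    \<comment> \<open>Since p R \<le> q, one and the same q is admissible in (A1) for every element
      of the ball that contains the support of y^p.\<close>
    have "cmod ((\<integral>\<omega>. normalized_trace (\<pi> n \<omega> g) \<partial>M n)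
        - complex_of_real (\<Sum>k<q. u k g / real n ^ k)) \<le> ?b" if "word_length S g \<le> p * R" for g
      by (rule A1) (use that \<open>1 \<le> q\<close> \<open>1 \<le> n\<close> \<open>p * R \<le> q\<close> \<open>C * real q powr C \<le> real n\<close> in linarith)+
    then have "cmod (a n p - (\<Sum>k<q. v k p / of_nat n ^ k)) \<le> ga_l1_norm y ^ p * ?b"
      unfolding a_def v_def ga_linear_ext_diff_expansion[symmetric]
      by (intro norm_ga_linear_ext_power_le[OF assms(2) R]) auto
    also have "\<dots> \<le> K ^ p * ?b"
      by (intro mult_right_mono power_mono ga_l1_norm_nonneg) (auto simp: K_def)
    finally show ?thesis .
  qed
  have v0: "cmod (v 0 p) \<le> r ^ p" for p
  proof -
    have "complex_of_real (u 0 g) = (if g = 0 then 1 else 0)" for g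
      unfolding assms(5) canonical_trace_left_regular ..
    then have "v 0 p = ga_linear_ext (\<lambda>g. if g = 0 then 1 else 0) (y ^ p)" by (simp only: v_def)
    then have "cmod (v 0 p) \<le> ell2_opnorm (left_regular_ext y) ^ p"
      using ga_linear_ext_delta_power_le[of y p] by simp
    also have "\<dots> \<le> r ^ p"
      using norm_y cr by (intro power_mono ell2_opnorm_left_regular_ext_nonneg) auto
    finally show ?thesis .
  qed
  have "limsup (\<lambda>p. ereal (cmod (v 1 p) powr (1 / real p))) \<le> ereal (ell2_opnorm (left_regular_ext y))"
    unfolding v_def by (rule A2) (simp add: y_def ga_selfadjoint_star_mult)
  also have "\<dots> < ereal r" using norm_y cr by simp
  finally obtain C1 where v1: "\<And>p. cmod (v 1 p) \<le> C1 * r ^ p"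
    using geometric_bound_of_limsup_root[of "\<lambda>p. cmod (v 1 p)" r] r0 by auto
  have bound: "cmod (moment (a n) h) \<le> b" if "1 \<le> n" "\<And>t. 0 \<le> t \<Longrightarrow> t \<le> K \<Longrightarrow> \<bar>poly h t\<bar> \<le> b" for n h b
    using norm_expectation_moment_le[OF assms(3)[OF that(1)] that(1), of x K h b] that(2)
    by (simp add: a_def[abs_def] y_def K_def)
  have "r' \<le> K" by (simp add: K_def)
  from r0 rr' this assms(4)
  obtain h where h: "\<And>n t. 0 \<le> t \<Longrightarrow> t \<le> K \<Longrightarrow> 0 \<le> poly (h n) t"
    "\<And>n t. r' \<le> t \<Longrightarrow> t \<le> K \<Longrightarrow> 1 \<le> poly (h n) t"
    "(\<lambda>n. real n * cmod (moment (a n) (h n))) \<longlonglongrightarrow> 0"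
    by (rule separating_moments_tendsto_0[of r r' K C R a v C1])
      ((rule expansion; assumption) | rule v0 | rule v1 | (rule bound; blast) | blast)+
  let ?P = "\<lambda>n. measure (M n) {\<omega> \<in> space (M n). mat_opnorm (rep_ext n (\<pi> n \<omega>) x) \<le> c + \<epsilon>}"
  have lower: "1 - real n * cmod (moment (a n) (h n)) \<le> ?P n" if n: "1 \<le> n" for n
    using prob_opnorm_ge[OF assms(3)[OF n] n, of x K "c + \<epsilon>" "h n"] h c0 \<epsilon>
    by (simp add: a_def[abs_def] y_def K_def r'_def)
  have upper: "?P n \<le> 1" if n: "1 \<le> n" for n
    using assms(3)[OF n] by (simp add: random_unitary_rep_def prob_space.prob_le_1)
  have "(\<lambda>n. 1 - real n * cmod (moment (a n) (h n))) \<longlonglongrightarrow> 1 - 0"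
    by (intro tendsto_diff tendsto_const h(3))
  then have lim: "(\<lambda>n. 1 - real n * cmod (moment (a n) (h n))) \<longlonglongrightarrow> 1" by simp
  have "?P \<longlonglongrightarrow> 1"
  proof (rule tendsto_sandwich[OF _ _ lim tendsto_const])
    show "\<forall>\<^sub>F n in sequentially. 1 - real n * cmod (moment (a n) (h n)) \<le> ?P n"
      using eventually_ge_at_top[of "1::nat"] by eventually_elim (rule lower)
    show "\<forall>\<^sub>F n in sequentially. ?P n \<le> 1"
      using eventually_ge_at_top[of "1::nat"] by eventually_elim (rule upper)
  qed
  then show "(\<lambda>n. measure (M n)
      {\<omega> \<in> space (M n). mat_opnorm (rep_ext n (\<pi> n \<omega>) x) \<le> ell2_opnorm (left_regular_ext x) + \<epsilon>}) \<longlonglongrightarrow> 1"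
    unfolding c_def .
qed

end
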